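(* Let $b\neq 0$ be a real number and consider the quadratic polynomial vector field $\dot x=y$, $\dot y=2bxy$. The following statements hold. (1) The first integral of the polynomial vector field is $I=I(x,y)=y-bx^{2}$. (2) The integral curve of the polynomial vector field is $(x(t),\dot x(t))$, where $$x(t)=\sqrt{\frac{k_1}{b}}\,\tan\left(\sqrt{k_1 b}\,(k_2+t)\right).$$ (3) The differential Galois group associated to the foliation is isomorphic to the identity group. (4) The connected identity component of the differential Galois group of the first variational equation around any particular solution is an abelian group.
   Context: In (2), $k_1,k_2$ are the constants of integration ($\dot x=bx^2+k_1$ and $\int dx/(bx^2+k_1)=t+k_2$). A first integral is a function $I$ with $\dot I=0$ along solutions. The foliation associated to a vector field $\dot x=P$, $\dot y=Q$ is the equation $y'=Q/P$, $'=d/dx$; here $y'=2bx$, considered over the differential field $\mathbb{C}(x)$. For a differential field $K$ and a Picard–Vessiot extension $L/K$ (the extension of $K$ by the solutions, having the same field of constants as $K$), the differential Galois group $DGal(L/K)$ is the group of automorphisms of $L$ that commute with the derivation and fix every element of $K$. For a particular solution $(x_0(t),y_0(t))$ with $y_0=\dot x_0$, the first variational equation is the linear system $\dot\xi=DX(x_0(t),y_0(t))\,\xi$, where $DX$ is the Jacobian matrix of the vector field.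
   Formalization: In (2) the square roots are taken with product k1 (principal roots give a wrong formula for b<0), and that every integral curve has the displayed form is claimed only for k1≠0 and non-equilibrium curves, as -1/(b(t+k2)) and nonzero constant solutions are not of that form. *)

theory Defs
  imports
    "HOL-Complex_Analysis.Complex_Analysis"
    "HOL-Computational_Algebra.Computational_Algebra"
    "HOL-Algebra.Bij"
    "HOL-Algebra.Elementary_Groups"
begin

section \<open>Vector fields, integral curves, first integrals\<close>

text \<open>
  Everything is complexified, so that square roots of negative numbers make sense. The time
  variable is complex (an open connected set) or real (an open interval, embedded in the complex
  plane). Real integral curves are the case of a real interval and real values.
\<close>

definition time_domain :: "complex set \<Rightarrow> bool" where
  "time_domain T \<longleftrightarrow>
     T \<noteq> {} \<and> ((open T \<and> connected T) \<or>
              (\<exists>J::real set. open J \<and> connected J \<and> T = complex_of_real ` J))"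

definition integral_curve ::
    "(complex^'n \<Rightarrow> complex^'n) \<Rightarrow> complex set \<Rightarrow> (complex \<Rightarrow> complex^'n) \<Rightarrow> bool" where
  "integral_curve F T \<gamma> \<longleftrightarrow>
     (\<forall>t\<in>T. \<forall>i. ((\<lambda>s. \<gamma> s $ i) has_field_derivative F (\<gamma> t) $ i) (at t within T))"

definition first_integral ::
    "(complex^'n \<Rightarrow> complex^'n) \<Rightarrow> (complex^'n \<Rightarrow> complex) \<Rightarrow> bool" where
  "first_integral F I \<longleftrightarrow>
     (\<forall>T \<gamma>. time_domain T \<and> integral_curve F T \<gamma> \<longrightarrow>
        (\<forall>t\<in>T. ((\<lambda>s. I (\<gamma> s)) has_field_derivative 0) (at t within T)))"

text \<open>The vector field \<open>x' = y\<close>, \<open>y' = 2 b x y\<close>, with \<open>p = (x, y)\<close>.\<close>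

definition quad_field :: "real \<Rightarrow> complex^2 \<Rightarrow> complex^2" where
  "quad_field b p = vector [p $ 2, 2 * of_real b * p $ 1 * p $ 2]"

text \<open>
  Branches \<open>r\<close> of \<open>sqrt (k / b)\<close> and \<open>s\<close> of \<open>sqrt (k b)\<close> are compatible if \<open>r s = k\<close>. For
  \<open>b > 0\<close> the principal branches are compatible; for \<open>b < 0\<close> their product is \<open>- k\<close>, and one
  of them has to be negated.
\<close>

definition sqrt_branches :: "real \<Rightarrow> complex \<Rightarrow> complex \<Rightarrow> complex \<Rightarrow> bool" where
  "sqrt_branches b k r s \<longleftrightarrow> r\<^sup>2 = k / of_real b \<and> s\<^sup>2 = k * of_real b \<and> r * s = k"

lemma sqrt_branches_ex:
  assumes "b \<noteq> 0"
  shows "sqrt_branches b k (csqrt (k * of_real b) / of_real b) (csqrt (k * of_real b))"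
proof -
  have "csqrt (k * of_real b) * csqrt (k * of_real b) = k * of_real b"
    by (metis power2_csqrt power2_eq_square)
  then show ?thesis
    using assms by (simp add: sqrt_branches_def field_simps power2_eq_square)
qed

lemma sqrt_branches_principal:
  assumes "b > 0"
  shows "sqrt_branches b k (csqrt (k / of_real b)) (csqrt (k * of_real b))"
proof -
  have "0 < Re (csqrt (k / of_real b)) \<or>
        Re (csqrt (k / of_real b)) = 0 \<and> 0 \<le> Im (csqrt (k / of_real b))"
    by (rule csqrt_principal)
  then have eq: "csqrt (k * of_real b) = of_real b * csqrt (k / of_real b)"
    using assms by (intro csqrt_unique) (auto simp: power_mult_distrib power2_eq_square[of "complex_of_real b"])
  have "csqrt (k / of_real b) * csqrt (k * of_real b) = of_real b * (csqrt (k / of_real b))\<^sup>2"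
    by (simp only: eq power2_eq_square mult_ac)
  also have "\<dots> = k"
    using assms by (simp only: power2_csqrt) simp
  finally show ?thesis
    by (simp add: sqrt_branches_def)
qed


section \<open>Differential fields\<close>

text \<open>
  A differential field is a pair of a subset \<open>F\<close> of a type of class \<open>field\<close> and a map \<open>D\<close>
  of which only the values on \<open>F\<close> matter.
\<close>

definition is_subfield :: "'a::field set \<Rightarrow> bool" where
  "is_subfield F \<longleftrightarrow> 0 \<in> F \<and> 1 \<in> F \<and>
     (\<forall>a\<in>F. \<forall>c\<in>F. a + c \<in> F \<and> a * c \<in> F) \<and> (\<forall>a\<in>F. - a \<in> F \<and> inverse a \<in> F)"

definition field_adjoin :: "'a::field set \<Rightarrow> 'a set \<Rightarrow> 'a set" where
  "field_adjoin F S = \<Inter>{E. is_subfield E \<and> F \<union> S \<subseteq> E}"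

definition differential_field :: "'a::field set \<Rightarrow> ('a \<Rightarrow> 'a) \<Rightarrow> bool" where
  "differential_field F D \<longleftrightarrow> is_subfield F \<and> (\<forall>a\<in>F. D a \<in> F) \<and>
     (\<forall>a\<in>F. \<forall>c\<in>F. D (a + c) = D a + D c \<and> D (a * c) = D a * c + a * D c)"

definition field_constants :: "'a::field set \<Rightarrow> ('a \<Rightarrow> 'a) \<Rightarrow> 'a set" where
  "field_constants F D = {a\<in>F. D a = 0}"

text \<open>
  The base field is embedded in the extension by \<open>\<iota>\<close>; injectivity is automatic for
  homomorphisms of fields.
\<close>

definition differential_extension ::
    "('k::field \<Rightarrow> 'l::field) \<Rightarrow> 'k set \<Rightarrow> ('k \<Rightarrow> 'k) \<Rightarrow> 'l set \<Rightarrow> ('l \<Rightarrow> 'l) \<Rightarrow> bool" where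
  "differential_extension \<iota> K DK L DL \<longleftrightarrow>
     differential_field K DK \<and> differential_field L DL \<and>
     \<iota> ` K \<subseteq> L \<and> \<iota> 1 = 1 \<and>
     (\<forall>a\<in>K. \<forall>c\<in>K. \<iota> (a + c) = \<iota> a + \<iota> c \<and> \<iota> (a * c) = \<iota> a * \<iota> c) \<and>
     (\<forall>a\<in>K. \<iota> (DK a) = DL (\<iota> a))"

definition no_new_constants ::
    "('k::field \<Rightarrow> 'l::field) \<Rightarrow> 'k set \<Rightarrow> ('k \<Rightarrow> 'k) \<Rightarrow> 'l set \<Rightarrow> ('l \<Rightarrow> 'l) \<Rightarrow> bool" where
  "no_new_constants \<iota> K DK L DL \<longleftrightarrow> field_constants L DL = \<iota> ` field_constants K DK"

text \<open>
  Picard--Vessiot extension for the linear system \<open>Y' = A Y\<close>, with fundamental matrix \<open>U\<close>.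
\<close>

definition picard_vessiot ::
    "('k::field \<Rightarrow> 'l::field) \<Rightarrow> 'k set \<Rightarrow> ('k \<Rightarrow> 'k) \<Rightarrow> 'k^'n^'n \<Rightarrow>
     'l set \<Rightarrow> ('l \<Rightarrow> 'l) \<Rightarrow> 'l^'n^'n \<Rightarrow> bool" where
  "picard_vessiot \<iota> K DK A L DL U \<longleftrightarrow>
     differential_extension \<iota> K DK L DL \<and> no_new_constants \<iota> K DK L DL \<and>
     (\<forall>i j. A $ i $ j \<in> K) \<and> (\<forall>i j. U $ i $ j \<in> L) \<and> invertible U \<and>
     map_matrix DL U = map_matrix \<iota> A ** U \<and>
     L = field_adjoin (\<iota> ` K) {U $ i $ j | i j. True}"

text \<open>
  Picard--Vessiot extension for the inhomogeneous scalar equation \<open>y' = f\<close>. The solutions form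
  a coset of the constants, so one solution in \<open>L\<close> amounts to a full set of solutions.
\<close>

definition picard_vessiot_primitive ::
    "('k::field \<Rightarrow> 'l::field) \<Rightarrow> 'k set \<Rightarrow> ('k \<Rightarrow> 'k) \<Rightarrow> 'k \<Rightarrow> 'l set \<Rightarrow> ('l \<Rightarrow> 'l) \<Rightarrow> bool" where
  "picard_vessiot_primitive \<iota> K DK f L DL \<longleftrightarrow>
     differential_extension \<iota> K DK L DL \<and> no_new_constants \<iota> K DK L DL \<and>
     f \<in> K \<and> {y\<in>L. DL y = \<iota> f} \<noteq> {} \<and>
     L = field_adjoin (\<iota> ` K) {y\<in>L. DL y = \<iota> f}"


section \<open>Differential Galois groups\<close>

definition DGal ::
    "('k::field \<Rightarrow> 'l::field) \<Rightarrow> 'k set \<Rightarrow> 'l set \<Rightarrow> ('l \<Rightarrow> 'l) \<Rightarrow> ('l \<Rightarrow> 'l) monoid" where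
  "DGal \<iota> K L DL = (BijGroup L)\<lparr>carrier := {\<sigma> \<in> Bij L.
     (\<forall>a\<in>L. \<forall>c\<in>L. \<sigma> (a + c) = \<sigma> a + \<sigma> c \<and> \<sigma> (a * c) = \<sigma> a * \<sigma> c) \<and>
     (\<forall>a\<in>L. \<sigma> (DL a) = DL (\<sigma> a)) \<and> (\<forall>a\<in>K. \<sigma> (\<iota> a) = \<iota> a)}\<rparr>"

inductive_set matrix_polynomials :: "'a::field set \<Rightarrow> ('a^'n^'n \<Rightarrow> 'a) set"
  for C :: "'a set" where
  const: "c \<in> C \<Longrightarrow> (\<lambda>_. c) \<in> matrix_polynomials C"
| entry: "(\<lambda>M. M $ i $ j) \<in> matrix_polynomials C"
| add: "f \<in> matrix_polynomials C \<Longrightarrow> g \<in> matrix_polynomials C \<Longrightarrow>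
          (\<lambda>M. f M + g M) \<in> matrix_polynomials C"
| mult: "f \<in> matrix_polynomials C \<Longrightarrow> g \<in> matrix_polynomials C \<Longrightarrow>
          (\<lambda>M. f M * g M) \<in> matrix_polynomials C"

text \<open>
  The Zariski topology on the \<open>n \<times> n\<close> matrices over a subfield \<open>C\<close>. It induces the Zariski
  topology of \<open>GL\<^sub>n(C)\<close>, since denominators \<open>det\<^sup>m\<close> can be cleared in polynomial equations.
\<close>

definition zariski :: "'a::field set \<Rightarrow> ('a^'n^'n) topology" where
  "zariski C = subtopology
     (topology_generated_by {{M. f M \<noteq> 0} | f. f \<in> matrix_polynomials C})
     {M. \<forall>i j. M $ i $ j \<in> C}"

text \<open>
  \<open>\<sigma> \<mapsto> U\<^sup>-\<^sup>1 \<sigma>(U)\<close> represents the differential Galois group faithfully as an algebraic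
  subgroup of \<open>GL\<^sub>n\<close> over the constants of \<open>L\<close>; the group carries the topology pulled back
  along this representation.
\<close>

definition gal_matrix :: "'l::field^'n^'n \<Rightarrow> ('l \<Rightarrow> 'l) \<Rightarrow> 'l^'n^'n" where
  "gal_matrix U \<sigma> = matrix_inv U ** map_matrix \<sigma> U"

definition identity_component ::
    "('k::field \<Rightarrow> 'l::field) \<Rightarrow> 'k set \<Rightarrow> 'l set \<Rightarrow> ('l \<Rightarrow> 'l) \<Rightarrow> 'l^'n^'n \<Rightarrow> ('l \<Rightarrow> 'l) set" where
  "identity_component \<iota> K L DL U =
     connected_component_of_set
       (pullback_topology (carrier (DGal \<iota> K L DL)) (gal_matrix U) (zariski (field_constants L DL)))
       \<one>\<^bsub>DGal \<iota> K L DL\<^esub>"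


section \<open>The base fields\<close>

text \<open>The derivation \<open>d/dx\<close> on the field of rational functions.\<close>

definition ratfun_deriv :: "complex poly fract \<Rightarrow> complex poly fract" where
  "ratfun_deriv r = (THE d. \<exists>p q. q \<noteq> 0 \<and> r = Fract p q \<and>
     d = Fract (pderiv p * q - p * pderiv q) (q * q))"

lemma ratfun_deriv_Fract:
  assumes "q \<noteq> 0"
  shows "ratfun_deriv (Fract p q) = Fract (pderiv p * q - p * pderiv q) (q * q)"
  unfolding ratfun_deriv_def
proof (rule the_equality)
  fix d'
  assume "\<exists>c d. d \<noteq> 0 \<and> Fract p q = Fract c d \<and>
            d' = Fract (pderiv c * d - c * pderiv d) (d * d)"
  then obtain c d where d: "d \<noteq> 0" and cd: "Fract p q = Fract c d"
    and d': "d' = Fract (pderiv c * d - c * pderiv d) (d * d)" by blast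
  have eq: "c * q = p * d"
    using cd assms d by (simp add: eq_fract)
  have "pderiv c * q + c * pderiv q = pderiv p * d + p * pderiv d"
    using arg_cong[OF eq, of pderiv] by (simp add: pderiv_mult algebra_simps)
  then have "(pderiv c * d - c * pderiv d) * (q * q) = (pderiv p * q - p * pderiv q) * (d * d)"
    using eq by algebra
  then show "d' = Fract (pderiv p * q - p * pderiv q) (q * q)"
    using assms d d' by (simp add: eq_fract)
qed (use assms in blast)

lemma differential_field_ratfun: "differential_field UNIV ratfun_deriv"
proof -
  have "ratfun_deriv (a + c) = ratfun_deriv a + ratfun_deriv c" for a c
  proof (cases a, cases c)
    fix p q u v
    assume *: "a = Fract p q" "q \<noteq> 0" "c = Fract u v" "v \<noteq> 0"
    then show ?thesis
      by (simp add: ratfun_deriv_Fract eq_fract pderiv_mult pderiv_add) (simp add: algebra_simps)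
  qed
  moreover have "ratfun_deriv (a * c) = ratfun_deriv a * c + a * ratfun_deriv c" for a c
  proof (cases a, cases c)
    fix p q u v
    assume *: "a = Fract p q" "q \<noteq> 0" "c = Fract u v" "v \<noteq> 0"
    then show ?thesis
      by (simp add: ratfun_deriv_Fract eq_fract pderiv_mult) (simp add: algebra_simps)
  qed
  ultimately show ?thesis
    by (simp add: differential_field_def is_subfield_def)
qed

text \<open>
  The foliation of \<open>quad_field b\<close> is \<open>y' = Q/P\<close>, with \<open>Q/P = 2 b x y / y = 2 b x\<close> in the
  rational functions of \<open>x\<close>.
\<close>

definition foliation_slope :: "real \<Rightarrow> complex poly fract" where
  "foliation_slope b = Fract [:0, 2 * of_real b:] 1"

lemma picard_vessiot_primitive_foliation:
  "picard_vessiot_primitive (\<lambda>a. a) UNIV ratfun_deriv (foliation_slope b) UNIV ratfun_deriv"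
proof -
  have "ratfun_deriv (Fract [:0, 0, of_real b:] 1) = foliation_slope b"
    by (simp add: ratfun_deriv_Fract foliation_slope_def pderiv_pCons)
  then show ?thesis
    using differential_field_ratfun
    by (auto simp: picard_vessiot_primitive_def differential_extension_def no_new_constants_def
        field_adjoin_def)
qed

lemma foliation_slope_eval:
  "p $ 2 \<noteq> 0 \<Longrightarrow> quad_field b p $ 2 / quad_field b p $ 1 = poly [:0, 2 * of_real b:] (p $ 1)"
  by (simp add: quad_field_def)

text \<open>
  Functions near \<open>t0\<close> are replaced by their expansions in the differential field of formal
  Laurent series. Since restriction to germs is injective on the meromorphic functions of a
  connected domain around \<open>t0\<close>, differential fields of meromorphic functions embed in it.
\<close>

definition germ :: "(complex \<Rightarrow> complex) \<Rightarrow> complex \<Rightarrow> complex fls" where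
  "germ f t0 = fps_to_fls (fps_expansion f t0)"

definition jacobian_matrix :: "(complex^'n \<Rightarrow> complex^'n) \<Rightarrow> complex^'n \<Rightarrow> complex^'n^'n" where
  "jacobian_matrix F p = (\<chi> i j. deriv (\<lambda>h. F (p + axis j h) $ i) 0)"

lemma jacobian_matrix_quad_field:
  "jacobian_matrix (quad_field b) p =
     vector [vector [0, 1], vector [2 * of_real b * p $ 2, 2 * of_real b * p $ 1]]"
proof -
  have ax: "axis i h $ j = (if j = i then h else 0)" for i j :: 2 and h :: complex
    by (simp add: axis_def)
  have "deriv (\<lambda>h. 2 * of_real b * (p $ 1 + h) * p $ 2) 0 = 2 * of_real b * p $ 2"
    and "deriv (\<lambda>h. 2 * of_real b * p $ 1 * (p $ 2 + h)) 0 = 2 * of_real b * p $ 1"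
    and "deriv (\<lambda>h. p $ 2 + h) 0 = 1"
    by (rule DERIV_imp_deriv; (auto intro!: derivative_eq_intros)?)+
  then show ?thesis
    by (simp add: jacobian_matrix_def quad_field_def vec_eq_iff forall_2 ax)
qed

text \<open>The coefficient matrix of the first variational equation along \<open>\<gamma>\<close>.\<close>

definition variational_matrix ::
    "(complex^'n \<Rightarrow> complex^'n) \<Rightarrow> (complex \<Rightarrow> complex^'n) \<Rightarrow> complex \<Rightarrow> complex fls^'n^'n" where
  "variational_matrix F \<gamma> t0 = (\<chi> i j. germ (\<lambda>t. jacobian_matrix F (\<gamma> t) $ i $ j) t0)"

text \<open>
  An admissible field of coefficients: it contains the complex numbers and the particular
  solution, for instance \<open>\<complex>(x\<^sub>0, y\<^sub>0)\<close>, \<open>\<complex>(t, x\<^sub>0, y\<^sub>0)\<close> or all meromorphic functions on a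
  connected domain of \<open>\<gamma>\<close>.
\<close>

definition coefficient_field :: "(complex \<Rightarrow> complex^'n) \<Rightarrow> complex \<Rightarrow> complex fls set \<Rightarrow> bool" where
  "coefficient_field \<gamma> t0 K \<longleftrightarrow> differential_field K fls_deriv \<and>
     range fls_const \<subseteq> K \<and> (\<forall>i. germ (\<lambda>t. \<gamma> t $ i) t0 \<in> K)"

end

theory Submission
  imports Defs
begin

text \<open>
  Along an integral curve \<open>y - b x\<^sup>2\<close> is a constant \<open>k\<close>, so \<open>x' = b x\<^sup>2 + k\<close>; the tangent formula is
  fitted at one time and propagated by uniqueness for a linear equation. The foliation \<open>y' = 2 b x\<close>
  has the rational solution \<open>b x\<^sup>2\<close>, so the Picard--Vessiot extension is trivial.

  The first integral also reduces the variational equation to a scalar equation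
  \<open>\<xi>' = 2 b x \<xi> + c\<close> with \<open>c\<close> constant. Either its homogeneous part or the equation itself has a
  solution in the base field, so the Galois group acts by translations or by scalings with
  constants; in fact the whole group is abelian, not only its identity component. The identity
  component is a subgroup because left translations are Zariski continuous.
\<close>

unbundle no Formal_Power_Series.fps_syntax

section \<open>The vector field and its integral curves\<close>

lemma time_domain_connected:
  assumes "time_domain T"
  shows "connected T"
  using assms connected_continuous_image[of _ complex_of_real]
  by (auto simp: time_domain_def intro: continuous_intros)

text \<open>In the open case small balls lie in \<open>T\<close>; in the real case a small ball
  meets \<open>T\<close> in the image of a real interval. Compactness provides maxima and convexity
  the mean value inequality, both uniformly for complex and real time.\<close>

lemma time_domain_compact_convex_nbhd:
  assumes T: "time_domain T" and t: "t \<in> T"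
  shows "\<exists>d>0. \<forall>e\<le>d. compact (cball t e \<inter> T) \<and> convex (cball t e \<inter> T)"
proof (cases "open T")
  case True
  then obtain d where d: "d > 0" "cball t d \<subseteq> T"
    using t open_contains_cball by blast
  have "cball t e \<inter> T = cball t e" if "e \<le> d" for e
    using d(2) subset_cball[OF that, of t] by blast
  then show ?thesis
    using d(1) by (intro exI[of _ d]) auto
next
  case False
  then obtain J :: "real set" where J: "open J" "T = complex_of_real ` J"
    using T by (auto simp: time_domain_def)
  then obtain u where u: "u \<in> J" "t = of_real u"
    using t by blast
  obtain d where d: "d > 0" "cball u d \<subseteq> J"
    using J u open_contains_cball by blast
  have "compact (cball t e \<inter> T) \<and> convex (cball t e \<inter> T)" if "e \<le> d" for e
  proof -
    have "cball u e \<subseteq> J"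
      using d(2) subset_cball[OF that, of u] by blast
    then have "cball t e \<inter> T = complex_of_real ` cball u e"
      unfolding J(2) u(2) by (auto simp: dist_of_real)
    moreover have "compact (complex_of_real ` cball u e)"
      by (intro compact_continuous_image continuous_intros compact_cball)
    moreover have "convex (complex_of_real ` cball u e)"
      by (intro convex_linear_image convex_cball bounded_linear.linear bounded_linear_of_real)
    ultimately show ?thesis by simp
  qed
  then show ?thesis
    using d(1) by blast
qed

text \<open>
  On a piece of diameter so small that the integral of \<open>a\<close> stays below \<open>1\<close>, the maximum of
  \<open>\<bar>g\<bar>\<close> is bounded by a proper fraction of itself; no primitive of \<open>a\<close> is required, which
  matters because \<open>T\<close> need not be simply connected.
\<close>

lemma linear_ode_zero:
  fixes g a :: "complex \<Rightarrow> complex"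
  assumes T: "time_domain T" and t0: "t0 \<in> T" "g t0 = 0"
    and a: "continuous_on T a"
    and g: "\<And>t. t \<in> T \<Longrightarrow> (g has_field_derivative a t * g t) (at t within T)"
    and t: "t \<in> T"
  shows "g t = 0"
proof -
  define Z where "Z = {t \<in> T. g t = 0}"
  have contg: "continuous_on T g"
    by (rule DERIV_continuous_on[OF g])
  have "closedin (top_of_set T) Z"
    unfolding Z_def using contg by (rule continuous_closedin_preimage_constant)
  moreover have "openin (top_of_set T) Z"
    unfolding openin_contains_cball
  proof (intro conjI ballI)
    show "Z \<subseteq> T" by (auto simp: Z_def)
    fix z assume "z \<in> Z"
    then have z: "z \<in> T" "g z = 0" by (auto simp: Z_def)
    obtain d where d: "d > 0"
      "\<And>e. e \<le> d \<Longrightarrow> compact (cball z e \<inter> T) \<and> convex (cball z e \<inter> T)"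
      using time_domain_compact_convex_nbhd[OF T z(1)] by blast
    have "compact (a ` (cball z d \<inter> T))"
      using d by (intro compact_continuous_image continuous_on_subset[OF a]) auto
    then obtain B where B: "B > 0" "\<And>s. s \<in> cball z d \<inter> T \<Longrightarrow> norm (a s) \<le> B"
      by (metis bounded_pos compact_imp_bounded imageI)
    \<comment> \<open>The radius makes \<open>e * B\<close> at most one half, which is the
      contraction factor below.\<close>
    define e where "e = min d (1 / (2 * B))"
    define S where "S = cball z e \<inter> T"
    have e: "0 < e" "e \<le> d" "e * B \<le> 1 / 2"
      using d(1) B(1) by (auto simp: e_def min_def field_simps)
    have S: "compact S" "convex S" "z \<in> S"
      using d(2)[OF e(2)] e(1) z(1) by (auto simp: S_def)
    have "continuous_on S (\<lambda>s. norm (g s))"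
      by (intro continuous_intros continuous_on_subset[OF contg]) (auto simp: S_def)
    then obtain m where m: "m \<in> S" "\<And>s. s \<in> S \<Longrightarrow> norm (g s) \<le> norm (g m)"
      using continuous_attains_sup[OF S(1)] S(3) by blast
    \<comment> \<open>Mean value inequality on the convex set \<open>S\<close>; since
      \<open>g z = 0\<close>, the left side is the norm of \<open>g m\<close>, the maximum
      itself.\<close>
    have "norm (g m - g z) \<le> (B * norm (g m)) * norm (m - z)"
    proof (rule field_differentiable_bound[OF S(2)])
      fix s assume s: "s \<in> S"
      show "(g has_field_derivative a s * g s) (at s within S)"
        using g[of s] s by (auto simp: S_def intro: DERIV_subset)
      have "norm (a s) \<le> B" "norm (g s) \<le> norm (g m)"
        using B(2)[of s] m(2)[OF s] s e(2) by (auto simp: S_def)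
      then show "norm (a s * g s) \<le> B * norm (g m)"
        using B(1) by (auto simp: norm_mult intro!: mult_mono)
    qed (use m S in auto)
    also have "norm (m - z) \<le> e"
      using m(1) by (auto simp: S_def dist_norm norm_minus_commute)
    then have "(B * norm (g m)) * norm (m - z) \<le> (B * norm (g m)) * e"
      using B(1) by (intro mult_left_mono) auto
    also have "\<dots> = (e * B) * norm (g m)"
      by simp
    also have "\<dots> \<le> 1 / 2 * norm (g m)"
      using e(3) by (intro mult_right_mono) auto
    finally have "g m = 0" using z by simp
    then have "cball z e \<inter> T \<subseteq> Z"
      using m(2) by (auto simp: Z_def S_def)
    then show "\<exists>e>0. cball z e \<inter> T \<subseteq> Z"
      using e(1) by blast
  qed
  moreover have "Z \<noteq> {}" using t0 by (auto simp: Z_def)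
  ultimately have "Z = T"
    using time_domain_connected[OF T] unfolding connected_clopen by blast
  then show ?thesis using t by (auto simp: Z_def)
qed

section \<open>The first integral along integral curves\<close>

lemma integral_curve_quad_field:
  "integral_curve (quad_field b) T \<gamma> \<longleftrightarrow>
     (\<forall>t\<in>T. ((\<lambda>s. \<gamma> s $ 1) has_field_derivative \<gamma> t $ 2) (at t within T) \<and>
            ((\<lambda>s. \<gamma> s $ 2) has_field_derivative 2 * of_real b * \<gamma> t $ 1 * \<gamma> t $ 2) (at t within T))"
  by (simp add: integral_curve_def quad_field_def forall_2)

lemma quad_field_first_integral_deriv:
  assumes "integral_curve (quad_field b) T \<gamma>" "t \<in> T"
  shows "((\<lambda>s. \<gamma> s $ 2 - of_real b * (\<gamma> s $ 1)\<^sup>2) has_field_derivative 0) (at t within T)"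
  using assms unfolding integral_curve_quad_field
  by (auto intro!: derivative_eq_intros simp: power2_eq_square)

lemma first_integral_quad_field:
  "first_integral (quad_field b) (\<lambda>p. p $ 2 - of_real b * (p $ 1)\<^sup>2)"
  using quad_field_first_integral_deriv by (auto simp: first_integral_def)

text \<open>The difference \<open>I t - I t0\<close> solves the linear equation with coefficient
  zero and vanishes at \<open>t0\<close>, so uniqueness makes \<open>I\<close> constant on complex
  and real time domains alike.\<close>

lemma quad_field_first_integral_const:
  assumes T: "time_domain T" and \<gamma>: "integral_curve (quad_field b) T \<gamma>"
  obtains k where "\<And>t. t \<in> T \<Longrightarrow> \<gamma> t $ 2 = of_real b * (\<gamma> t $ 1)\<^sup>2 + k"
proof -
  obtain t0 where t0: "t0 \<in> T" using T by (auto simp: time_domain_def)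
  define I where "I = (\<lambda>s. \<gamma> s $ 2 - of_real b * (\<gamma> s $ 1)\<^sup>2)"
  have "I t - I t0 = 0" if "t \<in> T" for t
  proof (rule linear_ode_zero[OF T t0, of "\<lambda>t. I t - I t0" "\<lambda>_. 0"])
    show "((\<lambda>t. I t - I t0) has_field_derivative 0 * (I t - I t0)) (at t within T)" if "t \<in> T" for t
      using DERIV_diff[OF quad_field_first_integral_deriv[OF \<gamma> that] DERIV_const[of "I t0"]]
      by (simp add: I_def)
  qed (use that in auto)
  then have "\<And>t. t \<in> T \<Longrightarrow> \<gamma> t $ 2 = of_real b * (\<gamma> t $ 1)\<^sup>2 + I t0"
    by (simp add: I_def algebra_simps)
  then show thesis by (rule that)
qed

section \<open>The tangent solutions\<close>

lemma tan_solution_deriv: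
  assumes "b \<noteq> 0" and rs: "sqrt_branches b k r s" and c: "cos (s * (k2 + t)) \<noteq> 0"
  shows "((\<lambda>t. r * tan (s * (k2 + t))) has_field_derivative
            of_real b * (r * tan (s * (k2 + t)))\<^sup>2 + k) (at t)"
proof -
  have eq: "of_real b * r\<^sup>2 = k" "r * s = k"
    using assms by (auto simp: sqrt_branches_def)
  \<comment> \<open>This is what remains of r s / cos^2 = b r^2 tan^2 + k after clearing cos^2,
    because r s and b r^2 both equal k.\<close>
  have "k * (sin (s * (k2 + t)))\<^sup>2 + k * (cos (s * (k2 + t)))\<^sup>2 = k"
    by (metis distrib_left mult.right_neutral sin_cos_squared_add)
  then have "r * (inverse ((cos (s * (k2 + t)))\<^sup>2) * s) = of_real b * (r * tan (s * (k2 + t)))\<^sup>2 + k"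
    using c eq(2) by (simp add: tan_def power_mult_distrib power_divide field_simps eq(1)[symmetric])
  then show ?thesis
    using c by (auto intro!: derivative_eq_intros simp: mult_ac)
qed

lemma tan_solution_integral_curve:
  assumes "b \<noteq> 0" "sqrt_branches b k r s" "\<And>t. t \<in> T \<Longrightarrow> cos (s * (k2 + t)) \<noteq> 0"
  defines "x \<equiv> \<lambda>t. r * tan (s * (k2 + t))"
  shows "integral_curve (quad_field b) T (\<lambda>t. vector [x t, deriv x t])"
    and "\<And>t. t \<in> T \<Longrightarrow> deriv x t = of_real b * (x t)\<^sup>2 + k"
proof -
  have D: "(x has_field_derivative of_real b * (x t)\<^sup>2 + k) (at t)" if "t \<in> T" for t
    unfolding x_def using assms(1-3) that by (intro tan_solution_deriv)
  show d: "deriv x t = of_real b * (x t)\<^sup>2 + k" if "t \<in> T" for t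
    using D[OF that] by (rule DERIV_imp_deriv)
  have "(deriv x has_field_derivative 2 * of_real b * x t * deriv x t) (at t within T)"
    if t: "t \<in> T" for t
  \<comment> \<open>On \<open>T\<close> the function \<open>deriv x\<close> agrees with
    \<open>b x^2 + k\<close>, whose derivative is known; the radius one is arbitrary, as the
    agreement holds on all of \<open>T\<close>.\<close>
  proof (rule has_field_derivative_transform_within[OF _ zero_less_one t])
    show "((\<lambda>t. of_real b * (x t)\<^sup>2 + k) has_field_derivative 2 * of_real b * x t * deriv x t)
      (at t within T)"
      using has_field_derivative_at_within[OF D[OF t]]
      by (auto intro!: derivative_eq_intros simp: d[OF t])
  qed (simp add: d)
  then show "integral_curve (quad_field b) T (\<lambda>t. vector [x t, deriv x t])"
    using D d by (simp add: integral_curve_quad_field has_field_derivative_at_within)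
qed

text \<open>
  The phase \<open>k2\<close> is fitted at one time \<open>t1\<close>. Globally, \<open>g = x cos \<theta> - r sin \<theta>\<close> with
  \<open>\<theta> = s (k2 + t)\<close> satisfies \<open>g' = b x g\<close>, so it vanishes identically.
\<close>

lemma quad_field_curve_is_tan:
  assumes b: "b \<noteq> 0" and T: "time_domain T" and \<gamma>: "integral_curve (quad_field b) T \<gamma>"
    and k: "\<And>t. t \<in> T \<Longrightarrow> \<gamma> t $ 2 = of_real b * (\<gamma> t $ 1)\<^sup>2 + k" "k \<noteq> 0"
    and t1: "t1 \<in> T" "\<gamma> t1 $ 2 \<noteq> 0" and rs: "sqrt_branches b k r s"
  obtains k2 where
    "\<And>t. t \<in> T \<Longrightarrow> cos (s * (k2 + t)) \<noteq> 0 \<and>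
       \<gamma> t = vector [r * tan (s * (k2 + t)), deriv (\<lambda>t. r * tan (s * (k2 + t))) t]"
proof -
  have eq: "of_real b * r\<^sup>2 = k" "r * s = k"
    using b rs by (auto simp: sqrt_branches_def)
  then have r: "r \<noteq> 0" "s \<noteq> 0" and s: "s = of_real b * r"
    using k(2) by (auto simp: power2_eq_square)
  define w where "w = Arctan (\<gamma> t1 $ 1 / r)"
  \<comment> \<open>The tangent omits exactly the values i and -i. Reaching one of them would give b
    x^2 + k = 0 at \<open>t1\<close>, that is, y = 0 there.\<close>
  have "(\<gamma> t1 $ 1 / r)\<^sup>2 \<noteq> -1"
  proof
    assume "(\<gamma> t1 $ 1 / r)\<^sup>2 = -1"
    then have "(\<gamma> t1 $ 1)\<^sup>2 = - r\<^sup>2"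
      using r by (simp add: power_divide field_simps)
    then show False using k(1)[OF t1(1)] t1(2) eq(1) by simp
  qed
  then have w: "tan w = \<gamma> t1 $ 1 / r" unfolding w_def by (rule tan_Arctan)
  \<comment> \<open>If cos w were 0, division by zero would make tan w = 0; but then x = 0 at
    \<open>t1\<close>, so w = Arctan 0 = 0, where the cosine is 1.\<close>
  have cw: "cos w \<noteq> 0"
    using w by (cases "\<gamma> t1 $ 1 / r = 0") (auto simp: w_def tan_def)
  define k2 where "k2 = w / s - t1"
  have \<theta>1: "s * (k2 + t1) = w" using r by (simp add: k2_def)
  define g where "g = (\<lambda>t. \<gamma> t $ 1 * cos (s * (k2 + t)) - r * sin (s * (k2 + t)))"
  have x': "((\<lambda>s. \<gamma> s $ 1) has_field_derivative \<gamma> t $ 2) (at t within T)" if "t \<in> T" for t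
    using \<gamma> that by (auto simp: integral_curve_quad_field)
  have "g t = 0" if "t \<in> T" for t
  proof (rule linear_ode_zero[OF T t1(1) _ _ _ that])
    show "g t1 = 0" using w cw r unfolding g_def \<theta>1 by (simp add: tan_def field_simps)
    show "continuous_on T (\<lambda>t. of_real b * \<gamma> t $ 1)"
      using x' by (intro continuous_intros DERIV_continuous_on) auto
    \<comment> \<open>The derivative is (b x^2 + k - r s) cos - s x sin; inserting r s = k and s = b
      r leaves b x (x cos - r sin).\<close>
    show "(g has_field_derivative of_real b * \<gamma> t $ 1 * g t) (at t within T)" if "t \<in> T" for t
      unfolding g_def
      apply (rule derivative_eq_intros x'[OF that] refl)+
      using k(1)[OF that] eq(1) by (simp add: s) (simp add: algebra_simps power2_eq_square)
  qed
  then have g0: "\<gamma> t $ 1 * cos (s * (k2 + t)) = r * sin (s * (k2 + t))" if "t \<in> T" for t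
    using that by (simp add: g_def)
  have c: "cos (s * (k2 + t)) \<noteq> 0" if "t \<in> T" for t
  proof
    assume "cos (s * (k2 + t)) = 0"
    with g0[OF that] r have "sin (s * (k2 + t)) = 0" by simp
    with \<open>cos (s * (k2 + t)) = 0\<close> show False
      using sin_cos_squared_add[of "s * (k2 + t)"] by simp
  qed
  have "\<gamma> t = vector [r * tan (s * (k2 + t)), deriv (\<lambda>t. r * tan (s * (k2 + t))) t]"
    if t: "t \<in> T" for t
  proof -
    have x: "\<gamma> t $ 1 = r * tan (s * (k2 + t))"
      using g0[OF t] c[OF t] by (simp add: tan_def field_simps)
    show ?thesis
      using DERIV_imp_deriv[OF tan_solution_deriv[OF b rs c[OF t]]] x k(1)[OF t]
      by (simp add: vec_eq_iff forall_2)
  qed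
  with c that show thesis by blast
qed

section \<open>Differential Galois groups\<close>

lemma is_subfieldD:
  assumes "is_subfield F"
  shows "0 \<in> F" "1 \<in> F" "a \<in> F \<Longrightarrow> c \<in> F \<Longrightarrow> a + c \<in> F" "a \<in> F \<Longrightarrow> c \<in> F \<Longrightarrow> a * c \<in> F"
    "a \<in> F \<Longrightarrow> - a \<in> F" "a \<in> F \<Longrightarrow> inverse a \<in> F"
    "a \<in> F \<Longrightarrow> c \<in> F \<Longrightarrow> a - c \<in> F" "a \<in> F \<Longrightarrow> c \<in> F \<Longrightarrow> a / c \<in> F"
  using assms unfolding is_subfield_def
  by (auto simp: divide_inverse) (metis add_uminus_conv_diff)

lemma field_adjoin_least:
  "is_subfield E \<Longrightarrow> F \<subseteq> E \<Longrightarrow> S \<subseteq> E \<Longrightarrow> field_adjoin F S \<subseteq> E"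
  by (auto simp: field_adjoin_def)

lemma differential_field_deriv:
  assumes "differential_field F D"
  shows "D 0 = 0" "D 1 = 0"
    "a \<in> F \<Longrightarrow> c \<in> F \<Longrightarrow> D (a - c) = D a - D c"
    "a \<in> F \<Longrightarrow> c \<in> F \<Longrightarrow> c \<noteq> 0 \<Longrightarrow> D (a / c) = (D a * c - a * D c) / c\<^sup>2"
proof -
  have F: "is_subfield F" and add: "\<And>a c. a \<in> F \<Longrightarrow> c \<in> F \<Longrightarrow> D (a + c) = D a + D c"
    and mult: "\<And>a c. a \<in> F \<Longrightarrow> c \<in> F \<Longrightarrow> D (a * c) = D a * c + a * D c"
    using assms by (auto simp: differential_field_def)
  note F = is_subfieldD[OF F]
  show "D 0 = 0" using add[OF F(1) F(1)] by (simp only: add_0_right add_cancel_right_right)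
  show "D 1 = 0" using mult[OF F(2) F(2)] by (simp only: mult_1_left mult_1_right add_cancel_right_right)
  show "D (a - c) = D a - D c" if "a \<in> F" "c \<in> F"
    using add[OF F(7)[OF that] that(2)] by simp
  \<comment> \<open>The product rule for (a / c) * c = a, solved for the derivative of the
    quotient.\<close>
  show "D (a / c) = (D a * c - a * D c) / c\<^sup>2" if "a \<in> F" "c \<in> F" "c \<noteq> 0"
    using mult[OF F(8)[OF that(1,2)] that(2)] that(3)
    by (simp add: field_simps power2_eq_square)
qed

lemma field_hom_image:
  fixes h :: "'k::field \<Rightarrow> 'l::field"
  assumes F: "is_subfield F" and h1: "h 1 = 1"
    and add: "\<And>a c. a \<in> F \<Longrightarrow> c \<in> F \<Longrightarrow> h (a + c) = h a + h c"
    and mult: "\<And>a c. a \<in> F \<Longrightarrow> c \<in> F \<Longrightarrow> h (a * c) = h a * h c"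
  shows "h 0 = 0" "a \<in> F \<Longrightarrow> h (- a) = - h a" "a \<in> F \<Longrightarrow> h (inverse a) = inverse (h a)"
    "is_subfield (h ` F)"
proof -
  note F = is_subfieldD[OF F]
  show h0: "h 0 = 0" using add[OF F(1) F(1)] by (simp only: add_0_right add_cancel_right_right)
  show neg: "h (- a) = - h a" if "a \<in> F" for a
    using add[OF that F(5)[OF that]] h0 by (simp add: eq_neg_iff_add_eq_0 add.commute)
  show inv: "h (inverse a) = inverse (h a)" if "a \<in> F" for a
  proof (cases "a = 0")
    case False
    then have "h a * h (inverse a) = 1"
      using mult[OF that F(6)[OF that]] h1 by simp
    then show ?thesis by (simp add: inverse_unique)
  qed (simp add: h0)
  show "is_subfield (h ` F)"
    unfolding is_subfield_def
  proof (intro conjI ballI)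
    show "0 \<in> h ` F" using F(1) h0 by force
    show "1 \<in> h ` F" using F(2) h1 by force
    fix a assume "a \<in> h ` F"
    then obtain a' where a: "a' \<in> F" "a = h a'" by blast
    show "- a \<in> h ` F" using a neg F(5) by (metis imageI)
    show "inverse a \<in> h ` F" using a inv F(6) by (metis imageI)
    fix c assume "c \<in> h ` F"
    then obtain c' where c: "c' \<in> F" "c = h c'" by blast
    show "a + c \<in> h ` F" "a * c \<in> h ` F"
      using a c add mult F(3,4) by (metis imageI)+
  qed
qed

text \<open>The set where two homomorphisms agree is a subfield, so once it contains the generators
  it contains everything adjoined.\<close>

lemma field_hom_eqI:
  fixes f g :: "'l::field \<Rightarrow> 'm::field"
  assumes L: "is_subfield (field_adjoin F S)"
    and f: "f 1 = 1" "\<And>a c. a \<in> field_adjoin F S \<Longrightarrow> c \<in> field_adjoin F S \<Longrightarrow> f (a + c) = f a + f c"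
      "\<And>a c. a \<in> field_adjoin F S \<Longrightarrow> c \<in> field_adjoin F S \<Longrightarrow> f (a * c) = f a * f c"
    and g: "g 1 = 1" "\<And>a c. a \<in> field_adjoin F S \<Longrightarrow> c \<in> field_adjoin F S \<Longrightarrow> g (a + c) = g a + g c"
      "\<And>a c. a \<in> field_adjoin F S \<Longrightarrow> c \<in> field_adjoin F S \<Longrightarrow> g (a * c) = g a * g c"
    and eq: "\<And>a. a \<in> F \<union> S \<Longrightarrow> f a = g a" and a: "a \<in> field_adjoin F S"
  shows "f a = g a"
proof -
  let ?L = "field_adjoin F S"
  define E where "E = {a \<in> ?L. f a = g a}"
  note hf = field_hom_image[OF L f] and hg = field_hom_image[OF L g]
  have "is_subfield E"
    unfolding is_subfield_def E_def
    using is_subfieldD[OF L] f g hf(1-3) hg(1-3) by auto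
  moreover have "F \<union> S \<subseteq> E"
    using eq by (auto simp: E_def field_adjoin_def)
  ultimately show ?thesis
    using field_adjoin_least[of E F S] a by (auto simp: E_def)
qed

section \<open>The differential Galois group as a group of bijections\<close>

lemma DGal_carrier:
  "\<sigma> \<in> carrier (DGal \<iota> K L D) \<longleftrightarrow> \<sigma> \<in> Bij L \<and>
     (\<forall>a\<in>L. \<forall>c\<in>L. \<sigma> (a + c) = \<sigma> a + \<sigma> c \<and> \<sigma> (a * c) = \<sigma> a * \<sigma> c) \<and>
     (\<forall>a\<in>L. \<sigma> (D a) = D (\<sigma> a)) \<and> (\<forall>a\<in>K. \<sigma> (\<iota> a) = \<iota> a)"
  by (simp add: DGal_def)

lemma DGal_mult:
  "\<sigma> \<in> carrier (DGal \<iota> K L D) \<Longrightarrow> \<tau> \<in> carrier (DGal \<iota> K L D) \<Longrightarrow>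
     \<sigma> \<otimes>\<^bsub>DGal \<iota> K L D\<^esub> \<tau> = compose L \<sigma> \<tau>"
  by (simp add: DGal_def BijGroup_def)

lemma DGal_group:
  assumes L: "differential_field L D" and K: "\<iota> ` K \<subseteq> L"
  shows "group (DGal \<iota> K L D)"
proof -
  interpret B: group "BijGroup L" by (rule group_BijGroup)
  have cL: "\<And>a c. a \<in> L \<Longrightarrow> c \<in> L \<Longrightarrow> a + c \<in> L" "\<And>a c. a \<in> L \<Longrightarrow> c \<in> L \<Longrightarrow> a * c \<in> L"
    "\<And>a. a \<in> L \<Longrightarrow> D a \<in> L"
    using L by (auto simp: differential_field_def is_subfield_def)
  have "subgroup (carrier (DGal \<iota> K L D)) (BijGroup L)"
  proof (rule B.subgroupI)
    show "carrier (DGal \<iota> K L D) \<subseteq> carrier (BijGroup L)"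
      by (auto simp: DGal_carrier BijGroup_def)
    have "(\<lambda>x\<in>L. x) \<in> carrier (DGal \<iota> K L D)"
      using cL K by (auto simp: DGal_carrier id_Bij)
    then show "carrier (DGal \<iota> K L D) \<noteq> {}" by blast
  next
    fix \<sigma> assume "\<sigma> \<in> carrier (DGal \<iota> K L D)"
    then have \<sigma>: "\<sigma> \<in> Bij L" and
      hom: "\<And>a c. a \<in> L \<Longrightarrow> c \<in> L \<Longrightarrow> \<sigma> (a + c) = \<sigma> a + \<sigma> c"
        "\<And>a c. a \<in> L \<Longrightarrow> c \<in> L \<Longrightarrow> \<sigma> (a * c) = \<sigma> a * \<sigma> c"
        "\<And>a. a \<in> L \<Longrightarrow> \<sigma> (D a) = D (\<sigma> a)" "\<And>a. a \<in> K \<Longrightarrow> \<sigma> (\<iota> a) = \<iota> a"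
      by (auto simp: DGal_carrier)
    define \<rho> where "\<rho> = inv_into L \<sigma>"
    have bij: "bij_betw \<sigma> L L" using \<sigma> by (simp add: Bij_def)
    have \<rho>: "\<And>a. a \<in> L \<Longrightarrow> \<rho> a \<in> L" "\<And>a. a \<in> L \<Longrightarrow> \<sigma> (\<rho> a) = a" "\<And>a. a \<in> L \<Longrightarrow> \<rho> (\<sigma> a) = a"
      using Bij_inv_into_mem[OF \<sigma>] bij_betw_inv_into_right[OF bij] bij_betw_inv_into_left[OF bij]
      by (auto simp: \<rho>_def)
    \<comment> \<open>Each identity for the inverse comes from applying \<rho> after \<sigma> to its
      right-hand side; the derivation and the base field are treated likewise.\<close>
    have "\<rho> (a + c) = \<rho> a + \<rho> c" "\<rho> (a * c) = \<rho> a * \<rho> c" if "a \<in> L" "c \<in> L" for a c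
      using \<rho>(3)[of "\<rho> a + \<rho> c"] \<rho>(3)[of "\<rho> a * \<rho> c"] \<rho>(1,2) hom(1,2) cL that by auto
    moreover have "\<rho> (D a) = D (\<rho> a)" if "a \<in> L" for a
      using \<rho>(3)[of "D (\<rho> a)"] \<rho>(1,2) hom(3) cL that by auto
    moreover have "\<rho> (\<iota> a) = \<iota> a" if "a \<in> K" for a
      using \<rho>(3)[of "\<iota> a"] hom(4) K that by auto
    ultimately show "inv\<^bsub>BijGroup L\<^esub> \<sigma> \<in> carrier (DGal \<iota> K L D)"
      using restrict_inv_into_Bij[OF \<sigma>] cL K \<rho>(1)
      by (auto simp: inv_BijGroup[OF \<sigma>] DGal_carrier \<rho>_def)
  next
    fix \<sigma> \<tau> assume *: "\<sigma> \<in> carrier (DGal \<iota> K L D)" "\<tau> \<in> carrier (DGal \<iota> K L D)"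
    then have "\<sigma> \<in> Bij L" "\<tau> \<in> Bij L" and "\<And>a. a \<in> L \<Longrightarrow> \<tau> a \<in> L"
      using Bij_imp_funcset[of \<tau> L] by (auto simp: DGal_carrier)
    then show "\<sigma> \<otimes>\<^bsub>BijGroup L\<^esub> \<tau> \<in> carrier (DGal \<iota> K L D)"
      using * cL K compose_Bij[of \<sigma> L \<tau>]
      by (auto simp: BijGroup_def DGal_carrier compose_def image_subset_iff)
  qed
  then have "group (BijGroup L \<lparr>carrier := carrier (DGal \<iota> K L D)\<rparr>)"
    by (rule B.subgroup_imp_group)
  then show ?thesis by (simp add: DGal_def)
qed

text \<open>Any solution differs from \<iota> u by a constant, and constants of \<open>L\<close>
  come from \<open>K\<close>. So all adjoined elements already lie in the image of \<open>K\<close>,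
  and an automorphism fixing \<open>K\<close> is the identity.\<close>

lemma DGal_primitive_trivial:
  fixes \<iota> :: "'k::field \<Rightarrow> 'l::field"
  assumes PV: "picard_vessiot_primitive \<iota> K DK f L D" and u: "u \<in> K" "DK u = f"
  shows "DGal \<iota> K L D \<cong> singleton_group z"
proof -
  have K: "is_subfield K" and L: "differential_field L D" "is_subfield L" and KL: "\<iota> ` K \<subseteq> L"
    and hom: "\<iota> 1 = 1" "\<And>a c. a \<in> K \<Longrightarrow> c \<in> K \<Longrightarrow> \<iota> (a + c) = \<iota> a + \<iota> c"
      "\<And>a c. a \<in> K \<Longrightarrow> c \<in> K \<Longrightarrow> \<iota> (a * c) = \<iota> a * \<iota> c" "\<And>a. a \<in> K \<Longrightarrow> \<iota> (DK a) = D (\<iota> a)"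
    and C: "{a\<in>L. D a = 0} = \<iota> ` {a\<in>K. DK a = 0}"
    and LA: "L = field_adjoin (\<iota> ` K) {y\<in>L. D y = \<iota> f}"
    using PV by (auto simp: picard_vessiot_primitive_def differential_extension_def
        differential_field_def no_new_constants_def field_constants_def)
  have sub: "is_subfield (\<iota> ` K)" by (rule field_hom_image(4)[OF K hom(1-3)])
  have "y \<in> \<iota> ` K" if "y \<in> L" "D y = \<iota> f" for y
  proof -
    have "\<iota> u \<in> L" "D (\<iota> u) = \<iota> f" using u KL hom(4) by auto
    with that have "y - \<iota> u \<in> {a\<in>L. D a = 0}"
      using differential_field_deriv(3)[OF L(1)] is_subfieldD(7)[OF L(2)] by simp
    then have "y - \<iota> u \<in> \<iota> ` K" using C by auto
    then show ?thesis
      using is_subfieldD(3)[OF sub, of "y - \<iota> u" "\<iota> u"] u(1) by simp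
  qed
  then have "L \<subseteq> \<iota> ` K"
    by (subst LA, intro field_adjoin_least[OF sub]) auto
  then have LK: "L = \<iota> ` K" using KL by blast
  interpret G: group "DGal \<iota> K L D" using L(1) KL by (rule DGal_group)
  \<comment> \<open>Elements of \<open>Bij L\<close> are extensional, so agreement on
    \<open>L\<close> is equality of functions.\<close>
  have "\<sigma> = (\<lambda>x\<in>L. x)" if "\<sigma> \<in> carrier (DGal \<iota> K L D)" for \<sigma>
    by (rule extensionalityI[of _ L])
      (use that LK in \<open>auto simp: DGal_carrier Bij_def\<close>)
  then have "carrier (DGal \<iota> K L D) \<subseteq> {\<one>\<^bsub>DGal \<iota> K L D\<^esub>}"
    by (auto simp: DGal_def BijGroup_def)
  then have "carrier (DGal \<iota> K L D) = {\<one>\<^bsub>DGal \<iota> K L D\<^esub>}"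
    using G.one_closed by blast
  then have "(\<lambda>_. z) \<in> iso (DGal \<iota> K L D) (singleton_group z)"
    by (simp add: iso_def bij_betw_def)
  then show ?thesis
    by (auto simp: is_iso_def)
qed

text \<open>The polynomial is b x^2, the rational solution of y' = 2 b x that trivialises the Galois
  group.\<close>

lemma foliation_slope_primitive:
  "ratfun_deriv (Fract [:0, 0, of_real b:] 1) = foliation_slope b"
  by (simp add: ratfun_deriv_Fract foliation_slope_def pderiv_pCons)

section \<open>The Zariski topology and the identity component\<close>

lemma subfield_sum:
  "is_subfield F \<Longrightarrow> (\<And>i. i \<in> I \<Longrightarrow> f i \<in> F) \<Longrightarrow> sum f I \<in> F"
  by (induction I rule: infinite_finite_induct) (auto simp: is_subfield_def)

lemma subfield_prod:
  "is_subfield F \<Longrightarrow> (\<And>i. i \<in> I \<Longrightarrow> f i \<in> F) \<Longrightarrow> prod f I \<in> F"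
  by (induction I rule: infinite_finite_induct) (auto simp: is_subfield_def)

lemma additive_sum_on_subfield:
  fixes h :: "'k::field \<Rightarrow> 'l::field"
  assumes F: "is_subfield F" and h0: "h 0 = 0"
    and add: "\<And>a c. a \<in> F \<Longrightarrow> c \<in> F \<Longrightarrow> h (a + c) = h a + h c"
    and f: "\<And>i. i \<in> I \<Longrightarrow> f i \<in> F"
  shows "h (sum f I) = (\<Sum>i\<in>I. h (f i))"
  using f by (induction I rule: infinite_finite_induct) (auto simp: h0 add subfield_sum[OF F])

lemma subfield_det:
  fixes A :: "'a::field^'n^'n"
  assumes F: "is_subfield F" and A: "\<And>i j. A $ i $ j \<in> F"
  shows "det A \<in> F"
proof -
  have "of_int (sign p) \<in> F" for p :: "'n \<Rightarrow> 'n"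
    using F by (cases p rule: sign_cases) (auto simp: is_subfield_def)
  then show ?thesis
    unfolding det_def using F A
    by (intro subfield_sum subfield_prod is_subfieldD(4)) auto
qed

lemma matrix_inv_cancel:
  fixes A :: "'a::semiring_1^'n^'n"
  assumes "invertible A"
  shows "A ** matrix_inv A = mat 1" "matrix_inv A ** A = mat 1"
  using assms someI_ex[of "\<lambda>B. A ** B = mat 1 \<and> B ** A = mat 1"]
  unfolding invertible_def matrix_inv_def by blast+

text \<open>Column \<open>j\<close> of the inverse solves A v = e_j, so Cramer's rule writes its
  entries as quotients of determinants over \<open>F\<close>.\<close>

lemma subfield_matrix_inv:
  fixes A :: "'a::field^'n^'n"
  assumes F: "is_subfield F" and A: "\<And>i j. A $ i $ j \<in> F" and inv: "invertible A"
  shows "matrix_inv A $ i $ j \<in> F"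
proof -
  have d: "det A \<noteq> 0" using inv invertible_det_nz by blast
  have "A *v column j (matrix_inv A) = column j (mat 1)"
    unfolding matrix_inv_cancel(1)[OF inv, symmetric]
    by (simp add: vec_eq_iff column_def matrix_vector_mult_def matrix_matrix_mult_def)
  then have "matrix_inv A $ i $ j =
      det (\<chi> k l. if l = i then column j (mat 1) $ k else A $ k $ l) / det A"
    unfolding cramer[OF d] by (simp add: vec_eq_iff column_def)
  also have "\<dots> \<in> F"
    using is_subfieldD(1,2)[OF F] A
    by (intro is_subfieldD(8)[OF F] subfield_det[OF F]) (auto simp: column_def mat_def)
  finally show ?thesis .
qed

section \<open>Polynomial functions and left translations of matrices\<close>

lemma matrix_polynomials_sum:
  assumes "0 \<in> C" "\<And>k. k \<in> I \<Longrightarrow> f k \<in> matrix_polynomials C"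
  shows "(\<lambda>M. \<Sum>k\<in>I. f k M) \<in> matrix_polynomials C"
  using assms(2)
  by (induction I rule: infinite_finite_induct)
    (auto intro: matrix_polynomials.intros assms(1))

text \<open>The entries of \<open>A ** M\<close> are linear forms in the entries of \<open>M\<close>
  with coefficients in \<open>C\<close>, so substituting them into a polynomial gives a
  polynomial.\<close>

lemma matrix_polynomials_compose_mult:
  fixes A :: "'a::field^'n^'n"
  assumes "f \<in> matrix_polynomials C" and C: "0 \<in> C" and A: "\<And>i j. A $ i $ j \<in> C"
  shows "(\<lambda>M. f (A ** M)) \<in> matrix_polynomials C"
  using assms(1)
proof induction
  case (entry i j)
  show ?case
    unfolding matrix_matrix_mult_def
    by (simp, intro matrix_polynomials_sum matrix_polynomials.intros C A)
qed (auto intro: matrix_polynomials.intros)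

text \<open>The constant polynomial 1 vanishes nowhere, so the whole matrix space is itself a
  generating open set.\<close>

lemma zariski_basis_covers:
  fixes C :: "'a::field set"
  assumes "1 \<in> C"
  shows "\<Union>{{M :: 'a^'n^'n. f M \<noteq> 0} | f. f \<in> matrix_polynomials C} = UNIV"
proof -
  have "{M :: 'a^'n^'n. (\<lambda>_. 1 :: 'a) M \<noteq> 0} \<in> {{M. f M \<noteq> 0} | f. f \<in> matrix_polynomials C}"
    by (rule CollectI, rule exI, rule conjI[OF refl], rule matrix_polynomials.const[OF assms])
  then have "(UNIV :: ('a^'n^'n) set) \<in> {{M. f M \<noteq> 0} | f. f \<in> matrix_polynomials C}"
    by simp
  then show ?thesis by blast
qed

lemma topspace_zariski:
  "1 \<in> C \<Longrightarrow> topspace (zariski C) = {M. \<forall>i j. M $ i $ j \<in> C}"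
  by (simp add: zariski_def zariski_basis_covers)

lemma zariski_continuous_mult_left:
  fixes A :: "'a::field^'n^'n"
  assumes C: "is_subfield C" and A: "\<And>i j. A $ i $ j \<in> C"
  shows "continuous_map (zariski C) (zariski C) (\<lambda>M. A ** M)"
proof -
  let ?B = "{{M. f M \<noteq> 0} | f. f \<in> matrix_polynomials C} :: ('a^'n^'n) set set"
  have U: "\<Union>?B = UNIV"
    by (rule zariski_basis_covers[OF is_subfieldD(2)[OF C]])
  have "continuous_map (topology_generated_by ?B) (topology_generated_by ?B) (\<lambda>M. A ** M)"
  proof (rule continuous_on_generated_topo)
    fix V assume "V \<in> ?B"
    then obtain f where f: "f \<in> matrix_polynomials C" "V = {M. f M \<noteq> 0}" by blast
    have "{M. f (A ** M) \<noteq> 0} \<in> ?B"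
      by (rule CollectI, rule exI[of _ "\<lambda>M. f (A ** M)"], rule conjI[OF refl],
          rule matrix_polynomials_compose_mult[OF f(1) is_subfieldD(1)[OF C] A])
    moreover have "(\<lambda>M. A ** M) -` V \<inter> topspace (topology_generated_by ?B) = {M. f (A ** M) \<noteq> 0}"
      unfolding topology_generated_by_topspace U f(2) by auto
    ultimately show "openin (topology_generated_by ?B)
        ((\<lambda>M. A ** M) -` V \<inter> topspace (topology_generated_by ?B))"
      by (simp only: topology_generated_by_Basis)
  qed (simp only: U subset_UNIV)
  moreover have "(A ** M) $ i $ j \<in> C" if "\<And>i j. M $ i $ j \<in> C" for M :: "'a^'n^'n" and i j
    using that A by (auto simp: matrix_matrix_mult_def intro!: subfield_sum[OF C] is_subfieldD(4)[OF C])
  ultimately show ?thesis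
    unfolding zariski_def continuous_map_in_subtopology
    by (auto intro: continuous_map_from_subtopology)
qed

text \<open>For g in the component H of the identity, the translate of H by the inverse of g is
  connected and contains the identity, hence lies in H. Only left translations enter; joint
  continuity of the multiplication, unsuited to the Zariski topology, is not asked for.\<close>

lemma subgroup_connected_component_one:
  fixes G (structure)
  assumes G: "group G" and X: "topspace X = carrier G"
    and cont: "\<And>g. g \<in> carrier G \<Longrightarrow> continuous_map X X (\<lambda>h. g \<otimes>\<^bsub>G\<^esub> h)"
  shows "subgroup (connected_component_of_set X \<one>\<^bsub>G\<^esub>) G"
proof -
  interpret group G by (rule G)
  define H where "H = connected_component_of_set X \<one>\<^bsub>G\<^esub>"
  have HG: "H \<subseteq> carrier G"
    unfolding H_def X[symmetric] by (rule connected_component_of_subset_topspace)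
  have 1: "\<one> \<in> H"
    by (simp add: H_def connected_component_of_refl X)
  have quot: "inv g \<otimes> h \<in> H" if g: "g \<in> H" and h: "h \<in> H" for g h
  proof -
    have gG: "g \<in> carrier G" using g HG by blast
    have "connectedin X ((\<lambda>h. inv g \<otimes> h) ` H)"
      unfolding H_def
      by (rule connectedin_continuous_map_image[OF cont[OF inv_closed[OF gG]]
            connectedin_connected_component_of])
    moreover have "\<one> \<in> (\<lambda>h. inv g \<otimes> h) ` H"
      using g gG by (metis imageI l_inv)
    ultimately have "(\<lambda>h. inv g \<otimes> h) ` H \<subseteq> H"
      unfolding H_def by (rule connected_component_of_maximal)
    then show ?thesis using h by blast
  qed
  have inv: "inv g \<in> H" if "g \<in> H" for g
    using quot[OF that 1] that HG by auto
  have "g \<otimes> h \<in> H" if "g \<in> H" "h \<in> H" for g h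
    using quot[OF inv[OF that(1)] that(2)] that HG by auto
  then have "subgroup H G"
    using HG 1 inv by (intro subgroupI) auto
  then show ?thesis by (simp add: H_def)
qed

section \<open>The matrix representation of the Galois group\<close>

lemma picard_vessiotD:
  assumes "picard_vessiot \<iota> K DK A L D U"
  shows "differential_field K DK" "differential_field L D" "\<iota> ` K \<subseteq> L"
    "is_subfield K" "is_subfield L"
    "\<iota> 1 = 1" "\<And>a c. a \<in> K \<Longrightarrow> c \<in> K \<Longrightarrow> \<iota> (a + c) = \<iota> a + \<iota> c"
    "\<And>a c. a \<in> K \<Longrightarrow> c \<in> K \<Longrightarrow> \<iota> (a * c) = \<iota> a * \<iota> c" "\<And>a. a \<in> K \<Longrightarrow> D (\<iota> a) = \<iota> (DK a)"
    "\<And>a. a \<in> L \<Longrightarrow> D a = 0 \<Longrightarrow> a \<in> \<iota> ` K"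
    "\<And>i j. A $ i $ j \<in> K" "\<And>i j. U $ i $ j \<in> L" "invertible U"
    "map_matrix D U = map_matrix \<iota> A ** U"
    "L = field_adjoin (\<iota> ` K) {U $ i $ j | i j. True}"
  using assms
  by (auto simp: picard_vessiot_def differential_extension_def differential_field_def
      no_new_constants_def field_constants_def)

lemma subfield_constants:
  assumes L: "differential_field L D"
  shows "is_subfield (field_constants L D)"
proof -
  have F: "is_subfield L" and add: "\<And>a c. a \<in> L \<Longrightarrow> c \<in> L \<Longrightarrow> D (a + c) = D a + D c"
    and mult: "\<And>a c. a \<in> L \<Longrightarrow> c \<in> L \<Longrightarrow> D (a * c) = D a * c + a * D c"
    using L by (auto simp: differential_field_def)
  note F = is_subfieldD[OF F] and D = differential_field_deriv[OF L]
  have "D (- a) = 0" if "a \<in> L" "D a = 0" for a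
    using D(3)[OF F(1) that(1)] D(1) that(2) by simp
  moreover have "D (inverse a) = 0" if "a \<in> L" "D a = 0" for a
    using D(4)[OF F(2) that(1)] D(1,2) that(2) by (cases "a = 0") (auto simp: divide_inverse)
  ultimately show ?thesis
    using F D add mult by (auto simp: field_constants_def is_subfield_def)
qed

text \<open>An automorphism fixes \<open>A\<close> and commutes with the derivation, so \<sigma>(U)
  solves the same system as U; two fundamental matrices differ by a right factor with constant
  entries.\<close>

lemma gal_matrix:
  fixes U :: "'l::field^'n^'n"
  assumes PV: "picard_vessiot \<iota> K DK A L D U" and \<sigma>: "\<sigma> \<in> carrier (DGal \<iota> K L D)"
  shows "map_matrix \<sigma> U = U ** gal_matrix U \<sigma>"
    and "gal_matrix U \<sigma> $ i $ j \<in> field_constants L D"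
proof -
  note pv = picard_vessiotD[OF PV]
  let ?M = "gal_matrix U \<sigma>"
  show eq: "map_matrix \<sigma> U = U ** ?M"
    by (simp add: gal_matrix_def matrix_mul_assoc matrix_inv_cancel[OF pv(13)])
  have \<sigma>L: "\<sigma> a \<in> L" if "a \<in> L" for a
    using \<sigma> that Bij_imp_funcset by (auto simp: DGal_carrier)
  have hom: "\<And>a c. a \<in> L \<Longrightarrow> c \<in> L \<Longrightarrow> \<sigma> (a + c) = \<sigma> a + \<sigma> c"
    "\<And>a c. a \<in> L \<Longrightarrow> c \<in> L \<Longrightarrow> \<sigma> (a * c) = \<sigma> a * \<sigma> c"
    "\<And>a. a \<in> L \<Longrightarrow> D (\<sigma> a) = \<sigma> (D a)" "\<And>a. a \<in> K \<Longrightarrow> \<sigma> (\<iota> a) = \<iota> a"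
    using \<sigma> by (auto simp: DGal_carrier)
  have \<sigma>0: "\<sigma> 0 = 0"
    using hom(1)[of 0 0] is_subfieldD(1)[OF pv(5)] by (simp only: add_0_right add_cancel_right_right)
  have D: "D 0 = 0" "\<And>a c. a \<in> L \<Longrightarrow> c \<in> L \<Longrightarrow> D (a + c) = D a + D c"
      "\<And>a c. a \<in> L \<Longrightarrow> c \<in> L \<Longrightarrow> D (a * c) = D a * c + a * D c" "\<And>a. a \<in> L \<Longrightarrow> D a \<in> L"
    using pv(2) differential_field_deriv(1)[OF pv(2)] by (auto simp: differential_field_def)
  have \<iota>L: "\<iota> (A $ i $ j) \<in> L" for i j using pv(3,11) by blast
  have M_in: "?M $ i $ j \<in> L" for i j
    unfolding gal_matrix_def
    by (auto simp: matrix_matrix_mult_def intro!: subfield_sum[OF pv(5)] is_subfieldD(4)[OF pv(5)]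
        subfield_matrix_inv[OF pv(5) pv(12,13)] \<sigma>L pv(12))
  have DU: "D (U $ i $ j) = (\<Sum>k\<in>UNIV. \<iota> (A $ i $ k) * U $ k $ j)" for i j
    using pv(14) by (simp add: vec_eq_iff matrix_matrix_mult_def)
  have "map_matrix D (map_matrix \<sigma> U) = map_matrix \<iota> A ** map_matrix \<sigma> U"
    using pv(11,12) \<iota>L
    by (simp add: vec_eq_iff matrix_matrix_mult_def hom(3) DU hom(2,4)
        additive_sum_on_subfield[OF pv(5) \<sigma>0 hom(1)] is_subfieldD(4)[OF pv(5)])
  moreover have "map_matrix D (U ** ?M) = map_matrix D U ** ?M + U ** map_matrix D ?M"
    using pv(12) M_in D(4)
    by (simp add: vec_eq_iff matrix_matrix_mult_def D(3) sum.distrib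
        additive_sum_on_subfield[OF pv(5) D(1,2)] is_subfieldD(4)[OF pv(5)])
  \<comment> \<open>With \<sigma>(U) = U M, the two expressions for its derivative are A U M and A U
    M + U M'.\<close>
  ultimately have "U ** map_matrix D ?M = 0"
    unfolding eq pv(14) by (simp add: matrix_mul_assoc)
  then have "matrix_inv U ** (U ** map_matrix D ?M) = 0"
    by (simp add: matrix_matrix_mult_def vec_eq_iff)
  then have "map_matrix D ?M = 0"
    by (simp add: matrix_mul_assoc matrix_inv_cancel[OF pv(13)])
  then show "?M $ i $ j \<in> field_constants L D"
    using M_in by (simp add: field_constants_def vec_eq_iff)
qed

text \<open>The entries of the matrix of \<tau> are constants, hence come from \<open>K\<close> and
  are fixed by \<sigma>; applying \<sigma> to U M therefore changes only the factor U.\<close>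

lemma gal_matrix_compose:
  fixes U :: "'l::field^'n^'n"
  assumes PV: "picard_vessiot \<iota> K DK A L D U"
    and \<sigma>: "\<sigma> \<in> carrier (DGal \<iota> K L D)" and \<tau>: "\<tau> \<in> carrier (DGal \<iota> K L D)"
  shows "gal_matrix U (compose L \<sigma> \<tau>) = gal_matrix U \<sigma> ** gal_matrix U \<tau>"
proof -
  note pv = picard_vessiotD[OF PV]
  have hom: "\<And>a c. a \<in> L \<Longrightarrow> c \<in> L \<Longrightarrow> \<sigma> (a + c) = \<sigma> a + \<sigma> c"
    "\<And>a c. a \<in> L \<Longrightarrow> c \<in> L \<Longrightarrow> \<sigma> (a * c) = \<sigma> a * \<sigma> c" "\<And>a. a \<in> K \<Longrightarrow> \<sigma> (\<iota> a) = \<iota> a"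
    using \<sigma> by (auto simp: DGal_carrier)
  have \<sigma>0: "\<sigma> 0 = 0"
    using hom(1)[of 0 0] is_subfieldD(1)[OF pv(5)] by (simp only: add_0_right add_cancel_right_right)
  have M: "gal_matrix U \<tau> $ i $ j \<in> L" "\<sigma> (gal_matrix U \<tau> $ i $ j) = gal_matrix U \<tau> $ i $ j" for i j
    using gal_matrix(2)[OF PV \<tau>, of i j] pv(10) hom(3) by (fastforce simp: field_constants_def)+
  have "map_matrix (compose L \<sigma> \<tau>) U = map_matrix \<sigma> (map_matrix \<tau> U)"
    using pv(12) by (simp add: vec_eq_iff compose_def)
  also have "\<dots> = map_matrix \<sigma> U ** gal_matrix U \<tau>"
    unfolding gal_matrix(1)[OF PV \<tau>] using pv(12) M
    by (simp add: vec_eq_iff matrix_matrix_mult_def hom(2)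
        additive_sum_on_subfield[OF pv(5) \<sigma>0 hom(1)] is_subfieldD(4)[OF pv(5)])
  finally show ?thesis
    by (simp add: gal_matrix_def matrix_mul_assoc)
qed

lemma identity_component_subgroup:
  fixes U :: "'l::field^'n^'n"
  assumes PV: "picard_vessiot \<iota> K DK A L D U"
  shows "subgroup (identity_component \<iota> K L D U) (DGal \<iota> K L D)"
proof -
  note pv = picard_vessiotD[OF PV]
  let ?G = "DGal \<iota> K L D" and ?C = "field_constants L D"
  define X where "X = pullback_topology (carrier ?G) (gal_matrix U) (zariski ?C)"
  interpret G: group ?G using pv(2,3) by (rule DGal_group)
  have C: "is_subfield ?C" using pv(2) by (rule subfield_constants)
  have X: "topspace X = carrier ?G"
    using gal_matrix(2)[OF PV]
    by (auto simp: X_def topspace_pullback_topology topspace_zariski[OF is_subfieldD(2)[OF C]])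
  have "continuous_map X X (\<lambda>\<tau>. \<sigma> \<otimes>\<^bsub>?G\<^esub> \<tau>)" if \<sigma>: "\<sigma> \<in> carrier ?G" for \<sigma>
  proof -
    have "continuous_map X (zariski ?C) ((\<lambda>M. gal_matrix U \<sigma> ** M) \<circ> gal_matrix U)"
      unfolding X_def
      by (intro continuous_map_pullback zariski_continuous_mult_left C gal_matrix(2)[OF PV \<sigma>])
    \<comment> \<open>For the pulled-back topology continuity may be tested after
      \<open>gal_matrix U\<close>, where the translation by \<sigma> becomes multiplication by a
      constant matrix.\<close>
    then have "continuous_map X (zariski ?C) (gal_matrix U \<circ> (\<lambda>\<tau>. \<sigma> \<otimes>\<^bsub>?G\<^esub> \<tau>))"
      by (rule continuous_map_eq)
        (auto simp: X DGal_mult[OF \<sigma>] gal_matrix_compose[OF PV \<sigma>])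
    moreover have "topspace X \<subseteq> (\<lambda>\<tau>. \<sigma> \<otimes>\<^bsub>?G\<^esub> \<tau>) -` carrier ?G"
      using \<sigma> by (auto simp: X)
    ultimately show ?thesis
      by (subst (2) X_def) (rule continuous_map_pullback')
  qed
  then show ?thesis
    using subgroup_connected_component_one[OF G.is_group X]
    by (simp add: identity_component_def X_def)
qed

section \<open>The variational equation\<close>

lemma germ_const: "germ (\<lambda>_. c) t0 = fls_const c"
proof -
  have "fps_expansion (\<lambda>_. c) t0 = fps_const c"
    by (simp add: fps_eq_iff fps_expansion_def)
  then show ?thesis by (simp add: germ_def)
qed

lemma germ_mult:
  assumes "f analytic_on {t0}" "g analytic_on {t0}"
  shows "germ (\<lambda>t. f t * g t) t0 = germ f t0 * germ g t0"
proof -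
  have "(\<lambda>t. f (t0 + t) * g (t0 + t)) has_fps_expansion fps_expansion f t0 * fps_expansion g t0"
    by (intro has_fps_expansion_mult analytic_at_imp_has_fps_expansion assms)
  moreover have "(\<lambda>t. f (t0 + t) * g (t0 + t)) has_fps_expansion fps_expansion (\<lambda>t. f t * g t) t0"
    by (rule analytic_at_imp_has_fps_expansion[of "\<lambda>t. f t * g t"]) (intro analytic_on_mult assms)
  ultimately show ?thesis
    by (metis fps_expansion_unique_complex fls_times_fps_to_fls germ_def)
qed

text \<open>The expansion is defined coefficientwise by iterated \<open>deriv\<close> at
  \<open>t0\<close>, so this is an index shift, valid without analyticity.\<close>

lemma germ_deriv: "fls_deriv (germ f t0) = germ (deriv f) t0"
  by (simp add: germ_def fls_deriv_fps_to_fls fps_eq_iff fps_expansion_def funpow_swap1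
      del: of_nat_Suc)

lemma germ_cong:
  "open T \<Longrightarrow> t0 \<in> T \<Longrightarrow> (\<And>t. t \<in> T \<Longrightarrow> f t = g t) \<Longrightarrow> germ f t0 = germ g t0"
  unfolding germ_def
  by (metis (mono_tags, lifting) eventually_nhds fps_expansion_cong)

text \<open>On an open set an integral curve is holomorphic, so the system and its Jacobian pass to
  expansions. Afterwards the argument takes place purely in differential fields.\<close>

lemma quad_field_germs:
  fixes \<gamma> :: "complex \<Rightarrow> complex^2"
  assumes T: "open T" "t0 \<in> T" and \<gamma>: "integral_curve (quad_field b) T \<gamma>"
  defines "x \<equiv> germ (\<lambda>t. \<gamma> t $ 1) t0" and "y \<equiv> germ (\<lambda>t. \<gamma> t $ 2) t0"
    and "\<beta> \<equiv> fls_const (2 * of_real b)"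
  shows "fls_deriv x = y" "fls_deriv y = \<beta> * x * y"
    "variational_matrix (quad_field b) \<gamma> t0 = vector [vector [0, 1], vector [\<beta> * y, \<beta> * x]]"
proof -
  have D: "((\<lambda>s. \<gamma> s $ 1) has_field_derivative \<gamma> t $ 2) (at t)"
    "((\<lambda>s. \<gamma> s $ 2) has_field_derivative 2 * of_real b * \<gamma> t $ 1 * \<gamma> t $ 2) (at t)" if "t \<in> T" for t
    using \<gamma> that at_within_open[OF that T(1)] by (auto simp: integral_curve_def quad_field_def forall_2)
  have "(\<lambda>t. \<gamma> t $ 1) holomorphic_on T" "(\<lambda>t. \<gamma> t $ 2) holomorphic_on T"
    unfolding holomorphic_on_open[OF T(1)] by (rule ballI, rule exI, erule D)+
  then have an: "(\<lambda>t. \<gamma> t $ 1) analytic_on {t0}" "(\<lambda>t. \<gamma> t $ 2) analytic_on {t0}"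
    using T by (auto simp: analytic_at)
  have m: "germ (\<lambda>t. 2 * of_real b * f t) t0 = \<beta> * germ f t0" if "f analytic_on {t0}" for f
    unfolding \<beta>_def by (simp add: germ_mult[OF analytic_on_const that] germ_const)
  show "fls_deriv x = y"
    unfolding x_def y_def germ_deriv
    by (rule germ_cong[OF T]) (rule DERIV_imp_deriv[OF D(1)])
  have "fls_deriv y = germ (\<lambda>t. 2 * of_real b * (\<gamma> t $ 1 * \<gamma> t $ 2)) t0"
    unfolding y_def germ_deriv
    by (rule germ_cong[OF T]) (simp add: DERIV_imp_deriv[OF D(2)])
  also have "\<dots> = \<beta> * x * y"
    unfolding x_def y_def
    by (subst m) (use an in \<open>auto simp: germ_mult intro: analytic_on_mult\<close>)
  finally show "fls_deriv y = \<beta> * x * y" .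
  show "variational_matrix (quad_field b) \<gamma> t0 = vector [vector [0, 1], vector [\<beta> * y, \<beta> * x]]"
    using an by (simp add: variational_matrix_def jacobian_matrix_quad_field vec_eq_iff forall_2
        germ_const m x_def y_def)
qed

text \<open>
  A solution \<open>h\<close> of the homogeneous equation in \<open>K\<close> makes the Galois group act additively,
  \<open>u \<mapsto> u + m\<close>; a particular solution \<open>p\<close> in \<open>K\<close> makes it act multiplicatively,
  \<open>u - p \<mapsto> m (u - p)\<close>. In both cases \<open>m \<in> K\<close> is fixed by the group.
\<close>

lemma DGal_commute_first_order:
  assumes PV: "picard_vessiot \<iota> K DK A L D U"
    and \<sigma>: "\<sigma> \<in> carrier (DGal \<iota> K L D)" and \<tau>: "\<tau> \<in> carrier (DGal \<iota> K L D)"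
    and a: "a \<in> \<iota> ` K" and c: "c \<in> \<iota> ` K"
    and u: "u \<in> L" "D u = a * u + c"
    and hp: "(\<exists>h\<in>\<iota> ` K. h \<noteq> 0 \<and> D h = a * h) \<or> (\<exists>p\<in>\<iota> ` K. D p = a * p + c)"
  shows "\<sigma> (\<tau> u) = \<tau> (\<sigma> u)"
proof -
  note pv = picard_vessiotD[OF PV] and D = differential_field_deriv[OF picard_vessiotD(2)[OF PV]]
  note Lc = is_subfieldD[OF pv(5)]
  have KF: "is_subfield (\<iota> ` K)" by (rule field_hom_image(4)[OF pv(4,6,7,8)])
  note Kc = is_subfieldD[OF KF]
  have G: "\<rho> z \<in> L" "\<rho> (z + w) = \<rho> z + \<rho> w" "\<rho> (z * w) = \<rho> z * \<rho> w" "D (\<rho> z) = \<rho> (D z)"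
    if "\<rho> \<in> carrier (DGal \<iota> K L D)" "z \<in> L" "w \<in> L" for \<rho> z w
    using that Bij_imp_funcset[of \<rho> L] by (auto simp: DGal_carrier)
  have fixK: "\<rho> z = z" if "\<rho> \<in> carrier (DGal \<iota> K L D)" "z \<in> \<iota> ` K" for \<rho> z
    using that by (auto simp: DGal_carrier)
  have KL: "z \<in> L" if "z \<in> \<iota> ` K" for z using that pv(3) by blast
  \<comment> \<open>The quotient of two homogeneous solutions has derivative zero, and the constants
    of \<open>L\<close> lie in the image of \<open>K\<close>.\<close>
  have ratio: "\<exists>m\<in>\<iota> ` K. z = m * w" if "z \<in> L" "w \<in> L" "w \<noteq> 0" "D z = a * z" "D w = a * w" for z w
  proof -
    have "D (z / w) = 0" using D(4)[OF that(1,2,3)] that(4,5) by simp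
    then have "z / w \<in> \<iota> ` K" using pv(10) Lc(8)[OF that(1,2)] by blast
    then show ?thesis using that(3) by (intro bexI[of _ "z / w"]) auto
  qed
  show ?thesis
    using hp
  proof (elim disjE bexE conjE)
    fix h assume h: "h \<in> \<iota> ` K" "h \<noteq> 0" "D h = a * h"
    have add: "\<exists>m\<in>\<iota> ` K. \<rho> u = u + m" if \<rho>: "\<rho> \<in> carrier (DGal \<iota> K L D)" for \<rho>
    proof -
      have "D (\<rho> u) = \<rho> (a * u + c)" using G(4)[OF \<rho> u(1) u(1)] u(2) by simp
      also have "\<dots> = a * \<rho> u + c"
        using u(1) Lc(4) KL a c by (simp add: G(2,3)[OF \<rho>] fixK[OF \<rho>])
      finally have "D (\<rho> u - u) = a * (\<rho> u - u)"
        using D(3)[OF G(1)[OF \<rho> u(1) u(1)] u(1)] u(2) by (simp add: algebra_simps)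
      then obtain m where "m \<in> \<iota> ` K" "\<rho> u - u = m * h"
        using ratio[of "\<rho> u - u" h] h KL Lc(7) G(1)[OF \<rho> u(1) u(1)] u(1) by blast
      then show ?thesis
        using h(1) Kc(4) by (intro bexI[of _ "m * h"]) (auto simp: algebra_simps)
    qed
    obtain m n where mn: "m \<in> \<iota> ` K" "\<sigma> u = u + m" "n \<in> \<iota> ` K" "\<tau> u = u + n"
      using add[OF \<sigma>] add[OF \<tau>] by blast
    then show ?thesis
      using G(2)[OF \<sigma> u(1) KL] G(2)[OF \<tau> u(1) KL] fixK[OF \<sigma>] fixK[OF \<tau>] by simp
  next
    fix p assume p: "p \<in> \<iota> ` K" "D p = a * p + c"
    define w where "w = u - p"
    have w: "w \<in> L" "D w = a * w" "u = w + p"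
      using u p KL Lc(7) D(3)[OF u(1) KL[OF p(1)]] by (auto simp: w_def algebra_simps)
    have mult: "\<exists>m\<in>\<iota> ` K. \<rho> w = m * w" if \<rho>: "\<rho> \<in> carrier (DGal \<iota> K L D)" for \<rho>
    proof (cases "w = 0")
      \<comment> \<open>Here u = p lies in the base field, and any factor serves.\<close>
      case True
      then show ?thesis using fixK[OF \<rho> Kc(1)] Kc(1) by auto
    next
      case False
      have "D (\<rho> w) = a * \<rho> w"
        using G(4)[OF \<rho> w(1) w(1)] w(2) G(3)[OF \<rho> KL[OF a] w(1)] fixK[OF \<rho> a] by simp
      then show ?thesis
        using ratio[OF G(1)[OF \<rho> w(1) w(1)] w(1) False] w(2) by blast
    qed
    obtain m n where mn: "m \<in> \<iota> ` K" "\<sigma> w = m * w" "n \<in> \<iota> ` K" "\<tau> w = n * w"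
      using mult[OF \<sigma>] mult[OF \<tau>] by blast
    then show ?thesis
      unfolding w(3) using w(1) p(1) KL Lc(4)
      by (simp add: G(2,3)[OF \<sigma>] G(2,3)[OF \<tau>] fixK[OF \<sigma>] fixK[OF \<tau>])
  qed
qed

text \<open>An automorphism over \<open>K\<close> is determined by its values on the entries of
  \<open>U\<close>, so commutation needs to be checked only there.\<close>

lemma DGal_comm_group:
  assumes PV: "picard_vessiot \<iota> K DK A L D U"
    and comm: "\<And>\<sigma> \<tau> i j. \<sigma> \<in> carrier (DGal \<iota> K L D) \<Longrightarrow> \<tau> \<in> carrier (DGal \<iota> K L D) \<Longrightarrow>
      \<sigma> (\<tau> (U $ i $ j)) = \<tau> (\<sigma> (U $ i $ j))"
  shows "comm_group (DGal \<iota> K L D)"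
proof -
  note pv = picard_vessiotD[OF PV]
  interpret G: group "DGal \<iota> K L D" using pv(2,3) by (rule DGal_group)
  show ?thesis
  proof (rule G.group_comm_groupI)
    fix \<sigma> \<tau> assume \<sigma>: "\<sigma> \<in> carrier (DGal \<iota> K L D)" and \<tau>: "\<tau> \<in> carrier (DGal \<iota> K L D)"
    have hom: "compose L \<rho> \<rho>' 1 = 1"
      "z \<in> L \<Longrightarrow> w \<in> L \<Longrightarrow> compose L \<rho> \<rho>' (z + w) = compose L \<rho> \<rho>' z + compose L \<rho> \<rho>' w"
      "z \<in> L \<Longrightarrow> w \<in> L \<Longrightarrow> compose L \<rho> \<rho>' (z * w) = compose L \<rho> \<rho>' z * compose L \<rho> \<rho>' w"
      "k \<in> K \<Longrightarrow> compose L \<rho> \<rho>' (\<iota> k) = \<iota> k"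
      if "\<rho> \<in> carrier (DGal \<iota> K L D)" "\<rho>' \<in> carrier (DGal \<iota> K L D)" for \<rho> \<rho>' z w k
    proof -
      have c: "compose L \<rho> \<rho>' \<in> carrier (DGal \<iota> K L D)"
        using G.m_closed[OF that] by (simp add: DGal_mult[OF that])
      then show
        "z \<in> L \<Longrightarrow> w \<in> L \<Longrightarrow> compose L \<rho> \<rho>' (z + w) = compose L \<rho> \<rho>' z + compose L \<rho> \<rho>' w"
        "z \<in> L \<Longrightarrow> w \<in> L \<Longrightarrow> compose L \<rho> \<rho>' (z * w) = compose L \<rho> \<rho>' z * compose L \<rho> \<rho>' w"
        "k \<in> K \<Longrightarrow> compose L \<rho> \<rho>' (\<iota> k) = \<iota> k"
        by (auto simp: DGal_carrier)
      show "compose L \<rho> \<rho>' 1 = 1"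
        using c is_subfieldD(2)[OF pv(4)] pv(6) by (force simp: DGal_carrier)
    qed
    have "compose L \<sigma> \<tau> z = compose L \<tau> \<sigma> z" if "z \<in> L" for z
    proof (rule field_hom_eqI[of "\<iota> ` K" "{U $ i $ j | i j. True}" "compose L \<sigma> \<tau>" "compose L \<tau> \<sigma>",
          folded pv(15)])
      fix v assume "v \<in> \<iota> ` K \<union> {U $ i $ j | i j. True}"
      then show "compose L \<sigma> \<tau> v = compose L \<tau> \<sigma> v"
        using comm[OF \<sigma> \<tau>] pv(12) hom(4)[OF \<sigma> \<tau>] hom(4)[OF \<tau> \<sigma>]
        by (elim UnE imageE CollectE exE conjE) (simp_all add: compose_eq)
    qed (use pv(5) hom[OF \<sigma> \<tau>] hom[OF \<tau> \<sigma>] that in auto)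
    then have "compose L \<sigma> \<tau> = compose L \<tau> \<sigma>"
      by (intro extensionalityI[of _ L]) auto
    then show "\<sigma> \<otimes>\<^bsub>DGal \<iota> K L D\<^esub> \<tau> = \<tau> \<otimes>\<^bsub>DGal \<iota> K L D\<^esub> \<sigma>"
      by (simp add: DGal_mult \<sigma> \<tau>)
  qed
qed

text \<open>
  The first integral yields for each column of \<open>U\<close> the constant \<open>c = u2 - 2 b x u1\<close>, and hence
  \<open>u1' = 2 b x u1 + c\<close>. If \<open>y \<noteq> 0\<close>, then \<open>y\<close> solves the homogeneous equation. Otherwise \<open>x\<close> is
  a constant, and the particular solution \<open>- c / (2 b x)\<close> lies in \<open>K\<close> unless \<open>x = 0\<close>, in which case
  \<open>1\<close> solves the homogeneous equation.
\<close>

lemma variational_DGal_comm_group: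
  fixes \<gamma> :: "complex \<Rightarrow> complex^2" and U :: "'m::field^2^2"
  assumes T: "open T" "t0 \<in> T" and \<gamma>: "integral_curve (quad_field b) T \<gamma>"
    and K: "coefficient_field \<gamma> t0 K"
    and PV: "picard_vessiot \<iota> K fls_deriv (variational_matrix (quad_field b) \<gamma> t0) L D U"
  shows "comm_group (DGal \<iota> K L D)"
proof (rule DGal_comm_group[OF PV])
  fix \<sigma> \<tau> and i j :: 2
  assume \<sigma>: "\<sigma> \<in> carrier (DGal \<iota> K L D)" and \<tau>: "\<tau> \<in> carrier (DGal \<iota> K L D)"
  note pv = picard_vessiotD[OF PV] and dD = differential_field_deriv[OF picard_vessiotD(2)[OF PV]]
  have KF: "is_subfield (\<iota> ` K)" by (rule field_hom_image(4)[OF pv(4,6,7,8)])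
  note Lc = is_subfieldD[OF pv(5)] and Kc = is_subfieldD[OF KF]
  have \<iota>0: "\<iota> 0 = 0" by (rule field_hom_image(1)[OF pv(4,6,7,8)])
  have \<iota>nz: "\<iota> k \<noteq> 0" if "k \<in> K" "k \<noteq> 0" for k
    using pv(8)[OF that(1) is_subfieldD(6)[OF pv(4) that(1)]] that pv(6) by auto
  have KL: "z \<in> L" if "z \<in> \<iota> ` K" for z using that pv(3) by blast
  have Dmult: "\<And>z w. z \<in> L \<Longrightarrow> w \<in> L \<Longrightarrow> D (z * w) = D z * w + z * D w"
    using pv(2) by (auto simp: differential_field_def)
  define x where "x = germ (\<lambda>t. \<gamma> t $ 1) t0"
  define y where "y = germ (\<lambda>t. \<gamma> t $ 2) t0"
  define \<beta> :: "complex fls" where "\<beta> = fls_const (2 * of_real b)"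
  note germs = quad_field_germs[OF T \<gamma>, folded x_def y_def \<beta>_def]
  have in_K: "x \<in> K" "y \<in> K" "\<beta> \<in> K"
    using K by (auto simp: coefficient_field_def x_def y_def \<beta>_def)
  have prod_K: "\<beta> * x \<in> K" "\<beta> * y \<in> K" using in_K is_subfieldD(4)[OF pv(4)] by auto
  define a where "a = \<iota> (\<beta> * x)"
  define u where "u = U $ 1 $ j"
  define c where "c = U $ 2 $ j - a * u"
  have a: "a \<in> \<iota> ` K" using prod_K by (simp add: a_def)
  have uL: "u \<in> L" and cL: "c \<in> L"
    using pv(12) KL[OF a] Lc by (auto simp: u_def c_def)
  have Da: "D a = \<iota> (\<beta> * y)"
    using pv(9)[OF prod_K(1)] by (simp add: a_def germs(1)) (simp add: \<beta>_def)
  have DU: "D (U $ 1 $ j) = U $ 2 $ j" "D (U $ 2 $ j) = \<iota> (\<beta> * y) * U $ 1 $ j + a * U $ 2 $ j"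
    using pv(14) exhaust_2[of j] by (auto simp: vec_eq_iff forall_2 germs(3) matrix_matrix_mult_def sum_2 a_def \<iota>0 pv(6))
  have u: "D u = a * u + c" by (simp add: u_def c_def DU)
  have "D c = 0"
    \<comment> \<open>With u1' = u2 and a' = 2 b y, the second equation u2' = 2 b y u1 + a u2 is
      exactly (a u1)', so its difference with u2' cancels.\<close>
    unfolding c_def using pv(12) Lc(4) KL[OF a]
    by (simp add: dD(3) Dmult u_def DU Da)
  then have c: "c \<in> \<iota> ` K" using pv(10) cL by blast
  have "(\<exists>h\<in>\<iota> ` K. h \<noteq> 0 \<and> D h = a * h) \<or> (\<exists>p\<in>\<iota> ` K. D p = a * p + c)"
  proof (cases "y = 0")
    case False
    have "D (\<iota> y) = a * \<iota> y"
      using pv(9)[OF in_K(2)] pv(8)[OF prod_K(1) in_K(2)] by (simp add: germs(2) a_def)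
    then show ?thesis using \<iota>nz[OF in_K(2) False] in_K(2) by blast
  next
    case True
    then have "D a = 0" using Da \<iota>0 by simp
    show ?thesis
    proof (cases "a = 0")
      case True
      then show ?thesis using dD(2) Kc(2) by (intro disjI1 bexI[of _ 1]) auto
    next
      case False
      \<comment> \<open>Both \<open>c\<close> and \<open>a\<close> are constants here, so p = - c /
        a has derivative zero, which equals a p + c.\<close>
      have "D (c / a) = 0"
        using dD(4)[OF cL KL[OF a] False] \<open>D a = 0\<close> \<open>D c = 0\<close> by simp
      then have "D (- (c / a)) = 0"
        using dD(3)[OF Lc(1) Lc(8)[OF cL KL[OF a]]] dD(1) by simp
      then show ?thesis
        using False Kc(5)[OF Kc(8)[OF c a]] by (intro disjI2 bexI[of _ "- (c / a)"]) auto
    qed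
  qed
  then have comm: "\<sigma> (\<tau> u) = \<tau> (\<sigma> u)"
    by (rule DGal_commute_first_order[OF PV \<sigma> \<tau> a c uL u])
  \<comment> \<open>The second row of \<open>U\<close> is c + a u with \<open>a\<close> and
    \<open>c\<close> fixed by the group, so commutation on the first row carries over to it.\<close>
  have act: "\<rho> (c + a * z) = c + a * \<rho> z" "\<rho> z \<in> L" if "\<rho> \<in> carrier (DGal \<iota> K L D)" "z \<in> L" for \<rho> z
  proof -
    have "\<rho> (c + a * z) = \<rho> c + \<rho> a * \<rho> z"
      using that KL[OF a] cL Lc(4) by (simp add: DGal_carrier)
    moreover have "\<rho> c = c" "\<rho> a = a" using that(1) a c by (auto simp: DGal_carrier)
    ultimately show "\<rho> (c + a * z) = c + a * \<rho> z" by simp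
    show "\<rho> z \<in> L" using that Bij_imp_funcset[of \<rho> L] by (auto simp: DGal_carrier)
  qed
  have "U $ 2 $ j = c + a * u" by (simp add: c_def)
  then have "\<sigma> (\<tau> (U $ 2 $ j)) = \<tau> (\<sigma> (U $ 2 $ j))"
    using comm uL by (simp add: act \<sigma> \<tau>)
  with comm show "\<sigma> (\<tau> (U $ i $ j)) = \<tau> (\<sigma> (U $ i $ j))"
    using exhaust_2[of i] by (auto simp: u_def)
qed

lemma (in comm_group) subgroup_comm_group:
  "subgroup H G \<Longrightarrow> comm_group (G\<lparr>carrier := H\<rparr>)"
  by (rule group.group_comm_groupI[OF subgroup_imp_group])
    (auto intro: m_comm dest: subgroup.mem_carrier)

theorem theorem8p2:
  fixes b :: real
  assumes "b \<noteq> 0"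
  shows
    "(first_integral (quad_field b) (\<lambda>p. p $ 2 - of_real b * (p $ 1)\<^sup>2)) \<and>
     (\<forall>k1 k2 r s T. sqrt_branches b k1 r s \<and> time_domain T \<and> (\<forall>t\<in>T. cos (s * (k2 + t)) \<noteq> 0) \<longrightarrow>
        (let x = (\<lambda>t. r * tan (s * (k2 + t))) in
           integral_curve (quad_field b) T (\<lambda>t. vector [x t, deriv x t]) \<and>
           (\<forall>t\<in>T. deriv x t = of_real b * (x t)\<^sup>2 + k1))) \<and>
     (\<forall>T \<gamma>. time_domain T \<and> integral_curve (quad_field b) T \<gamma> \<longrightarrow>
        (\<exists>k1. (\<forall>t\<in>T. \<gamma> t $ 2 = of_real b * (\<gamma> t $ 1)\<^sup>2 + k1) \<and>
           (k1 \<noteq> 0 \<and> (\<exists>t\<in>T. \<gamma> t $ 2 \<noteq> 0) \<longrightarrow>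
              (\<forall>r s. sqrt_branches b k1 r s \<longrightarrow>
                 (\<exists>k2. let x = (\<lambda>t. r * tan (s * (k2 + t))) in
                    \<forall>t\<in>T. cos (s * (k2 + t)) \<noteq> 0 \<and> \<gamma> t = vector [x t, deriv x t]))))) \<and>
     (\<forall>(\<iota> :: complex poly fract \<Rightarrow> 'l::field) L D.
        picard_vessiot_primitive \<iota> UNIV ratfun_deriv (foliation_slope b) L D \<longrightarrow>
        DGal \<iota> UNIV L D \<cong> singleton_group (1::int)) \<and>
     (\<forall>T \<gamma> t0 K (\<iota> :: complex fls \<Rightarrow> 'm::field) L D U.
        open T \<and> connected T \<and> t0 \<in> T \<and> integral_curve (quad_field b) T \<gamma> \<and>
        coefficient_field \<gamma> t0 K \<and>
        picard_vessiot \<iota> K fls_deriv (variational_matrix (quad_field b) \<gamma> t0) L D U \<longrightarrow>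
        comm_group ((DGal \<iota> K L D)\<lparr>carrier := identity_component \<iota> K L D U\<rparr>))"
proof (intro conjI allI impI; (elim conjE)?)
  show "first_integral (quad_field b) (\<lambda>p. p $ 2 - of_real b * (p $ 1)\<^sup>2)"
    by (rule first_integral_quad_field)
next
  fix k1 k2 r s T
  assume "sqrt_branches b k1 r s" "\<forall>t\<in>T. cos (s * (k2 + t)) \<noteq> 0"
  then show "let x = (\<lambda>t. r * tan (s * (k2 + t))) in
      integral_curve (quad_field b) T (\<lambda>t. vector [x t, deriv x t]) \<and>
      (\<forall>t\<in>T. deriv x t = of_real b * (x t)\<^sup>2 + k1)"
    using tan_solution_integral_curve[OF assms, of k1 r s T k2] by (simp add: Let_def)
next
  fix T \<gamma>
  assume T: "time_domain T" and \<gamma>: "integral_curve (quad_field b) T \<gamma>"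
  obtain k where k: "\<And>t. t \<in> T \<Longrightarrow> \<gamma> t $ 2 = of_real b * (\<gamma> t $ 1)\<^sup>2 + k"
    using quad_field_first_integral_const[OF T \<gamma>] by blast
  show "\<exists>k1. (\<forall>t\<in>T. \<gamma> t $ 2 = of_real b * (\<gamma> t $ 1)\<^sup>2 + k1) \<and>
      (k1 \<noteq> 0 \<and> (\<exists>t\<in>T. \<gamma> t $ 2 \<noteq> 0) \<longrightarrow>
        (\<forall>r s. sqrt_branches b k1 r s \<longrightarrow>
           (\<exists>k2. let x = (\<lambda>t. r * tan (s * (k2 + t))) in
              \<forall>t\<in>T. cos (s * (k2 + t)) \<noteq> 0 \<and> \<gamma> t = vector [x t, deriv x t])))"
  proof (rule exI[of _ k], intro conjI ballI allI impI)
    fix r s assume "k \<noteq> 0 \<and> (\<exists>t\<in>T. \<gamma> t $ 2 \<noteq> 0)" and rs: "sqrt_branches b k r s"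
    then obtain t1 where t1: "k \<noteq> 0" "t1 \<in> T" "\<gamma> t1 $ 2 \<noteq> 0" by blast
    obtain k2 where "\<And>t. t \<in> T \<Longrightarrow> cos (s * (k2 + t)) \<noteq> 0 \<and>
        \<gamma> t = vector [r * tan (s * (k2 + t)), deriv (\<lambda>t. r * tan (s * (k2 + t))) t]"
      using quad_field_curve_is_tan[OF assms T \<gamma> k t1 rs] by blast
    then show "\<exists>k2. let x = (\<lambda>t. r * tan (s * (k2 + t))) in
        \<forall>t\<in>T. cos (s * (k2 + t)) \<noteq> 0 \<and> \<gamma> t = vector [x t, deriv x t]"
      by (auto simp: Let_def)
  qed (rule k)
next
  fix \<iota> :: "complex poly fract \<Rightarrow> 'l" and L D
  assume "picard_vessiot_primitive \<iota> UNIV ratfun_deriv (foliation_slope b) L D"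
  then show "DGal \<iota> UNIV L D \<cong> singleton_group (1::int)"
    by (rule DGal_primitive_trivial) (rule UNIV_I foliation_slope_primitive)+
next
  fix T \<gamma> t0 K and \<iota> :: "complex fls \<Rightarrow> 'm" and L D U
  assume "open T" "t0 \<in> T" "integral_curve (quad_field b) T \<gamma>" "coefficient_field \<gamma> t0 K"
    and PV: "picard_vessiot \<iota> K fls_deriv (variational_matrix (quad_field b) \<gamma> t0) L D U"
  then have "comm_group (DGal \<iota> K L D)"
    by (rule variational_DGal_comm_group)
  then show "comm_group ((DGal \<iota> K L D)\<lparr>carrier := identity_component \<iota> K L D U\<rparr>)"
    using identity_component_subgroup[OF PV] by (rule comm_group.subgroup_comm_group)
qed

end
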